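(* Let $T$ be a complex torus with Lie algebra $\mathfrak{t}$ and let $(\mathcal{A},T)$ be a generalized pair such that $\mathcal{A}$ has at most countable dimension. Let $V$ be an irreducible $\mathcal{A}$-module. Then $V$ has the direct sum decomposition $$V=\bigoplus_{P\in\mathrm{Ass}_{\mathcal{U}(\mathfrak{t})}(V)}V^P .$$
   Context: All algebras are unital, associative and over $\mathbb{C}$. A complex torus here is an algebraic torus $(\mathbb{C}^\times)^n$. A \emph{generalized pair} $(\mathcal{A},T)$ consists of $T$, an algebra $\mathcal{A}$ on which $T$ acts rationally by algebra automorphisms (the action is locally finite and every finite-dimensional subrepresentation is a representation of the algebraic group $T$), and a $T$-equivariant algebra homomorphism $\iota\colon\mathcal{U}(\mathfrak{t})\to\mathcal{A}$ such that the differential of the $T$-action on $\mathcal{A}$ is $X\cdot a=[\iota(X),a]$ ($X\in\mathfrak{t}$, $a\in\mathcal{A}$). An $\mathcal{A}$-module is a $\mathcal{U}(\mathfrak{t})$-module via $\iota$. $\mathrm{Ass}_{\mathcal{U}(\mathfrak{t})}(V)$ is the set of associated primes of the $\mathcal{U}(\mathfrak{t})$-module $V$ (prime ideals of the form $\mathrm{Ann}_{\mathcal{U}(\mathfrak{t})}(v)$), and $V^P=\{v\in V: Pv=0\}$. *)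

theory Defs
  imports Complex_Main "HOL-Library.Countable_Set" "HOL-Library.Poly_Mapping"
begin

section \<open>Complex vector spaces, algebras and Lie algebras\<close>

class complex_vector = ab_group_add +
  fixes scaleC :: "complex \<Rightarrow> 'a \<Rightarrow> 'a" (infixr "*\<^sub>C" 75)
  assumes scaleC_add_right: "c *\<^sub>C (x + y) = c *\<^sub>C x + c *\<^sub>C y"
    and scaleC_add_left: "(c + d) *\<^sub>C x = c *\<^sub>C x + d *\<^sub>C x"
    and scaleC_scaleC: "c *\<^sub>C d *\<^sub>C x = (c * d) *\<^sub>C x"
    and scaleC_one: "1 *\<^sub>C x = x"

global_interpretation complex_vector: vector_space "scaleC :: complex \<Rightarrow> 'a \<Rightarrow> 'a :: complex_vector"
  by unfold_locales (rule scaleC_add_right scaleC_add_left scaleC_scaleC scaleC_one)+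

text \<open>
  The axiom \<open>0 \<noteq> 1\<close> of \<open>ring_1\<close> excludes only the zero algebra, which has no
  irreducible modules.
\<close>

class complex_algebra_1 = complex_vector + ring_1 +
  assumes mult_scaleC_left: "(c *\<^sub>C x) * y = c *\<^sub>C (x * y)"
    and mult_scaleC_right: "x * (c *\<^sub>C y) = c *\<^sub>C (x * y)"

class complex_lie_algebra = complex_vector +
  fixes lie_bracket :: "'a \<Rightarrow> 'a \<Rightarrow> 'a"
  assumes lie_bracket_add_left: "lie_bracket (x + y) z = lie_bracket x z + lie_bracket y z"
    and lie_bracket_add_right: "lie_bracket x (y + z) = lie_bracket x y + lie_bracket x z"
    and lie_bracket_scaleC_left: "lie_bracket (c *\<^sub>C x) y = c *\<^sub>C lie_bracket x y"
    and lie_bracket_scaleC_right: "lie_bracket x (c *\<^sub>C y) = c *\<^sub>C lie_bracket x y"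
    and lie_bracket_self: "lie_bracket x x = 0"
    and lie_bracket_jacobi:
      "lie_bracket x (lie_bracket y z) + lie_bracket y (lie_bracket z x)
        + lie_bracket z (lie_bracket x y) = 0"

definition complex_algebra_hom :: "('a :: complex_algebra_1 \<Rightarrow> 'b :: complex_algebra_1) \<Rightarrow> bool" where
  "complex_algebra_hom f \<longleftrightarrow>
     Vector_Spaces.linear scaleC scaleC f \<and> f 1 = 1 \<and> (\<forall>x y. f (x * y) = f x * f y)"

definition two_sided_ideal :: "'a :: ring_1 set \<Rightarrow> bool" where
  "two_sided_ideal I \<longleftrightarrow>
     0 \<in> I \<and> (\<forall>x\<in>I. \<forall>y\<in>I. x + y \<in> I) \<and> (\<forall>x\<in>I. \<forall>a. a * x \<in> I \<and> x * a \<in> I)"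

text \<open>Intended for commutative rings (it is applied to \<open>U(\<tt>)\<close> with \<open>\<tt>\<close> abelian).\<close>

definition prime_ideal :: "'a :: ring_1 set \<Rightarrow> bool" where
  "prime_ideal P \<longleftrightarrow>
     two_sided_ideal P \<and> P \<noteq> UNIV \<and> (\<forall>a b. a * b \<in> P \<longrightarrow> a \<in> P \<or> b \<in> P)"


section \<open>The universal enveloping algebra\<close>

text \<open>
  Words in the letters \<open>'g\<close> under concatenation, written additively so that the finitely
  supported functions \<open>'g word_monoid \<Rightarrow>\<^sub>0 complex\<close> carry the convolution product of
  \<open>Poly_Mapping\<close> and form the free algebra on the set \<open>'g\<close>.
\<close>

datatype 'g word_monoid = Word "'g list"

instantiation word_monoid :: (type) monoid_add
begin

definition "0 = Word []"

fun plus_word_monoid :: "'a word_monoid \<Rightarrow> 'a word_monoid \<Rightarrow> 'a word_monoid" where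
  "Word u + Word v = Word (u @ v)"

instance
proof
  fix a b c :: "'a word_monoid"
  show "a + b + c = a + (b + c)" by (cases a; cases b; cases c) simp
  show "0 + a = a" by (cases a) (simp add: zero_word_monoid_def)
  show "a + 0 = a" by (cases a) (simp add: zero_word_monoid_def)
qed

end

type_synonym 'g free_algebra = "'g word_monoid \<Rightarrow>\<^sub>0 complex"

definition letter :: "'g \<Rightarrow> 'g free_algebra" where
  "letter x = Poly_Mapping.single (Word [x]) 1"

abbreviation free_const :: "complex \<Rightarrow> 'g free_algebra" where
  "free_const c \<equiv> Poly_Mapping.single 0 c"

text \<open>
  The first two families of relations turn the free algebra on the set \<open>'g\<close> into the
  tensor algebra of the vector space \<open>'g\<close>.
\<close>

definition uea_relations :: "'g :: complex_lie_algebra free_algebra set" where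
  "uea_relations =
     {letter (x + y) - letter x - letter y | x y. True}
     \<union> {letter (c *\<^sub>C x) - free_const c * letter x | c x. True}
     \<union> {letter x * letter y - letter y * letter x - letter (lie_bracket x y) | x y. True}"

definition uea_ideal :: "'g :: complex_lie_algebra free_algebra set" where
  "uea_ideal = two_sided_ideal hull uea_relations"

lemma two_sided_ideal_uminus: "two_sided_ideal I \<Longrightarrow> x \<in> I \<Longrightarrow> - x \<in> I"
  unfolding two_sided_ideal_def by (metis mult_minus1)

lemma two_sided_ideal_Inter: "(\<And>I. I \<in> F \<Longrightarrow> two_sided_ideal I) \<Longrightarrow> two_sided_ideal (\<Inter>F)"
  unfolding two_sided_ideal_def by blast

lemma two_sided_ideal_uea_ideal: "two_sided_ideal uea_ideal"
  unfolding uea_ideal_def by (rule hull_in) (simp add: two_sided_ideal_Inter)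

lemma uea_relations_subset: "uea_relations \<subseteq> uea_ideal"
  unfolding uea_ideal_def by (rule hull_subset)

lemma uea_ideal_zero: "0 \<in> uea_ideal"
  and uea_ideal_add: "x \<in> uea_ideal \<Longrightarrow> y \<in> uea_ideal \<Longrightarrow> x + y \<in> uea_ideal"
  and uea_ideal_mult_left: "x \<in> uea_ideal \<Longrightarrow> a * x \<in> uea_ideal"
  and uea_ideal_mult_right: "x \<in> uea_ideal \<Longrightarrow> x * a \<in> uea_ideal"
  and uea_ideal_uminus: "x \<in> uea_ideal \<Longrightarrow> - x \<in> uea_ideal"
  using two_sided_ideal_uea_ideal two_sided_ideal_uminus[OF two_sided_ideal_uea_ideal]
  unfolding two_sided_ideal_def by blast+

lemma lookup_zero_mult:
  fixes f g :: "'g free_algebra"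
  shows "Poly_Mapping.lookup (f * g) 0 = Poly_Mapping.lookup f 0 * Poly_Mapping.lookup g 0"
proof -
  have split: "0 = l + q \<longleftrightarrow> l = 0 \<and> q = 0" for l q :: "'g word_monoid"
    by (cases l; cases q) (auto simp: zero_word_monoid_def)
  have "Poly_Mapping.lookup f l * Sum_any (\<lambda>q. Poly_Mapping.lookup g q when 0 = l + q)
      = (Poly_Mapping.lookup f 0 * Poly_Mapping.lookup g 0 when l = 0)" for l
    by (cases "l = 0") (simp_all add: split)
  thus ?thesis by (simp add: lookup_mult)
qed

lemma one_notin_uea_ideal: "1 \<notin> uea_ideal"
proof
  let ?J = "{f :: 'a free_algebra. Poly_Mapping.lookup f 0 = 0}"
  assume "1 \<in> (uea_ideal :: 'a free_algebra set)"
  moreover have "two_sided_ideal ?J"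
    by (simp add: two_sided_ideal_def lookup_add lookup_zero_mult)
  moreover have "Poly_Mapping.lookup (letter x) 0 = 0" for x :: 'a
    by (simp add: letter_def lookup_single zero_word_monoid_def)
  hence "uea_relations \<subseteq> ?J"
    by (auto simp: uea_relations_def lookup_minus lookup_zero_mult)
  ultimately have "1 \<in> ?J"
    unfolding uea_ideal_def by (meson hull_minimal subsetD)
  thus False by (simp add: lookup_one)
qed

lemma free_const_commute: "free_const c * f = f * free_const c"
proof (rule poly_mapping_eqI)
  fix k
  have "Poly_Mapping.lookup (free_const c * f) k = c * Poly_Mapping.lookup f k"
    by (simp add: lookup_mult lookup_single when_mult mult_when)
  moreover have "Sum_any (\<lambda>q. Poly_Mapping.lookup (free_const c) q when k = l + q) = (c when k = l)" for l
  proof -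
    have eq: "(\<lambda>q. Poly_Mapping.lookup (free_const c) q when k = l + q) = (\<lambda>q. (c when k = l) when q = 0)"
      by (auto simp: fun_eq_iff lookup_single when_def)
    show ?thesis unfolding eq by (rule Sum_any_when_equal)
  qed
  hence "Poly_Mapping.lookup (f * free_const c) k = Poly_Mapping.lookup f k * c"
    by (simp add: lookup_mult mult_when)
  ultimately show "Poly_Mapping.lookup (free_const c * f) k = Poly_Mapping.lookup (f * free_const c) k"
    by (simp add: mult.commute)
qed

quotient_type (overloaded) 'g uea = "'g :: complex_lie_algebra free_algebra" /
  "\<lambda>a b. a - b \<in> uea_ideal"
proof (rule equivpI)
  show "reflp (\<lambda>a b :: 'g free_algebra. a - b \<in> uea_ideal)"
    by (rule reflpI) (simp add: uea_ideal_zero)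
  show "symp (\<lambda>a b :: 'g free_algebra. a - b \<in> uea_ideal)"
    by (rule sympI) (metis minus_diff_eq uea_ideal_uminus)
  show "transp (\<lambda>a b :: 'g free_algebra. a - b \<in> uea_ideal)"
  proof (rule transpI)
    fix a b c :: "'g free_algebra"
    assume "a - b \<in> uea_ideal" "b - c \<in> uea_ideal"
    from uea_ideal_add[OF this] show "a - c \<in> uea_ideal" by simp
  qed
qed

instantiation uea :: (complex_lie_algebra) complex_algebra_1
begin

lift_definition zero_uea :: "'a uea" is 0 .
lift_definition one_uea :: "'a uea" is 1 .

lift_definition plus_uea :: "'a uea \<Rightarrow> 'a uea \<Rightarrow> 'a uea" is "(+)"
  by (metis add_diff_add uea_ideal_add)

lift_definition uminus_uea :: "'a uea \<Rightarrow> 'a uea" is uminus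
  by (metis minus_diff_minus uea_ideal_uminus)

lift_definition minus_uea :: "'a uea \<Rightarrow> 'a uea \<Rightarrow> 'a uea" is "(-)"
proof -
  fix a b c d :: "'a free_algebra"
  assume "a - b \<in> uea_ideal" "c - d \<in> uea_ideal"
  from uea_ideal_add[OF this(1) uea_ideal_uminus[OF this(2)]]
  show "(a - c) - (b - d) \<in> uea_ideal" by (simp add: algebra_simps)
qed

lift_definition times_uea :: "'a uea \<Rightarrow> 'a uea \<Rightarrow> 'a uea" is "(*)"
proof -
  fix a b c d :: "'a free_algebra"
  assume "a - b \<in> uea_ideal" "c - d \<in> uea_ideal"
  from uea_ideal_add[OF uea_ideal_mult_right[OF this(1), of c] uea_ideal_mult_left[OF this(2), of b]]
  show "a * c - b * d \<in> uea_ideal" by (simp add: algebra_simps)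
qed

lift_definition scaleC_uea :: "complex \<Rightarrow> 'a uea \<Rightarrow> 'a uea" is "\<lambda>c f. free_const c * f"
  by (metis right_diff_distrib uea_ideal_mult_left)

instance
proof
  fix a b c :: "'a uea" and r s :: complex
  show "a + b + c = a + (b + c)" by transfer (simp add: add.assoc uea_ideal_zero)
  show "a + b = b + a" by transfer (simp add: add.commute uea_ideal_zero)
  show "0 + a = a" by transfer (simp add: uea_ideal_zero)
  show "- a + a = 0" by transfer (simp add: uea_ideal_zero)
  show "a - b = a + - b" by transfer (simp add: uea_ideal_zero)
  show "a * b * c = a * (b * c)" by transfer (simp add: mult.assoc uea_ideal_zero)
  show "(a + b) * c = a * c + b * c" by transfer (simp add: distrib_right uea_ideal_zero)
  show "a * (b + c) = a * b + a * c" by transfer (simp add: distrib_left uea_ideal_zero)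
  show "1 * a = a" by transfer (simp add: uea_ideal_zero)
  show "a * 1 = a" by transfer (simp add: uea_ideal_zero)
  show "(0 :: 'a uea) \<noteq> 1"
    by transfer (metis diff_0 minus_minus one_notin_uea_ideal uea_ideal_uminus)
  show "r *\<^sub>C (a + b) = r *\<^sub>C a + r *\<^sub>C b" by transfer (simp add: distrib_left uea_ideal_zero)
  show "(r + s) *\<^sub>C a = r *\<^sub>C a + s *\<^sub>C a"
    by transfer (simp add: single_add distrib_right uea_ideal_zero)
  show "r *\<^sub>C s *\<^sub>C a = (r * s) *\<^sub>C a"
    by transfer (simp add: mult.assoc[symmetric] mult_single uea_ideal_zero)
  show "1 *\<^sub>C a = a" by transfer (simp add: uea_ideal_zero)
  show "(r *\<^sub>C a) * b = r *\<^sub>C (a * b)" by transfer (simp add: mult.assoc uea_ideal_zero)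
  show "a * (r *\<^sub>C b) = r *\<^sub>C (a * b)"
  proof transfer
    fix r and a b :: "'a free_algebra"
    have "a * (free_const r * b) = free_const r * (a * b)"
      by (metis free_const_commute mult.assoc)
    thus "a * (free_const r * b) - free_const r * (a * b) \<in> uea_ideal"
      by (simp add: uea_ideal_zero)
  qed
qed

end

text \<open>The canonical map \<open>\<gg> \<rightarrow> U(\<gg>)\<close>.\<close>

lift_definition uea_of :: "'g :: complex_lie_algebra \<Rightarrow> 'g uea" is letter .


section \<open>Complex tori\<close>

text \<open>
  The torus \<open>(\<complex>\<^sup>\<times>)\<^sup>n\<close>; coordinates with index \<open>\<ge> n\<close> are padded with the neutral
  element, and likewise with \<open>0\<close> for its Lie algebra \<open>\<complex>\<^sup>n\<close>.
\<close>

definition torus :: "nat \<Rightarrow> (nat \<Rightarrow> complex) set" where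
  "torus n = {t. (\<forall>i<n. t i \<noteq> 0) \<and> (\<forall>i\<ge>n. t i = 1)}"

definition torus_mult :: "(nat \<Rightarrow> complex) \<Rightarrow> (nat \<Rightarrow> complex) \<Rightarrow> (nat \<Rightarrow> complex)" where
  "torus_mult s t = (\<lambda>i. s i * t i)"

definition torus_one :: "nat \<Rightarrow> complex" where
  "torus_one = (\<lambda>_. 1)"

definition torus_exp :: "nat \<Rightarrow> (nat \<Rightarrow> complex) \<Rightarrow> (nat \<Rightarrow> complex)" where
  "torus_exp n x = (\<lambda>i. if i < n then exp (x i) else 1)"

text \<open>Regular functions on \<open>(\<complex>\<^sup>\<times>)\<^sup>n\<close> are the Laurent polynomials.\<close>

definition torus_regular :: "nat \<Rightarrow> ((nat \<Rightarrow> complex) \<Rightarrow> complex) \<Rightarrow> bool" where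
  "torus_regular n f \<longleftrightarrow>
     (\<exists>(S :: (nat \<Rightarrow> int) set) c. finite S \<and>
        (\<forall>t\<in>torus n. f t = (\<Sum>\<mu>\<in>S. c \<mu> * (\<Prod>i<n. t i powi \<mu> i))))"

text \<open>
  \<open>'g\<close> is identified with the Lie algebra \<open>\<complex>\<^sup>n\<close> of \<open>(\<complex>\<^sup>\<times>)\<^sup>n\<close> by a linear isomorphism
  \<open>coord\<close>.  Leaving \<open>'g\<close> abstract allows every \<open>n\<close>, including \<open>n = 0\<close>.
\<close>

definition torus_lie_algebra :: "nat \<Rightarrow> ('g :: complex_lie_algebra \<Rightarrow> nat \<Rightarrow> complex) \<Rightarrow> bool" where
  "torus_lie_algebra n coord \<longleftrightarrow>
     (\<forall>x y i. coord (x + y) i = coord x i + coord y i) \<and>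
     (\<forall>c x i. coord (c *\<^sub>C x) i = c * coord x i) \<and>
     bij_betw coord UNIV {z. \<forall>i\<ge>n. z i = 0} \<and>
     (\<forall>x y :: 'g. lie_bracket x y = 0)"


section \<open>Rational actions and generalized pairs\<close>

definition finite_dim_subrep ::
    "nat \<Rightarrow> ((nat \<Rightarrow> complex) \<Rightarrow> 'a :: complex_vector \<Rightarrow> 'a) \<Rightarrow> 'a set \<Rightarrow> bool" where
  "finite_dim_subrep n act W \<longleftrightarrow>
     (\<exists>B. finite B \<and> W = complex_vector.span B) \<and> (\<forall>t\<in>torus n. \<forall>w\<in>W. act t w \<in> W)"

text \<open>
  A finite-dimensional representation \<open>W\<close> is one of the algebraic group iff its matrix
  coefficients are regular functions; linear functionals on \<open>W\<close> are restrictions of linear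
  functionals on the whole space.
\<close>

definition rational_torus_action ::
    "nat \<Rightarrow> ((nat \<Rightarrow> complex) \<Rightarrow> 'a :: complex_vector \<Rightarrow> 'a) \<Rightarrow> bool" where
  "rational_torus_action n act \<longleftrightarrow>
     (\<forall>t\<in>torus n. Vector_Spaces.linear scaleC scaleC (act t)) \<and>
     (\<forall>a. act torus_one a = a) \<and>
     (\<forall>s\<in>torus n. \<forall>t\<in>torus n. \<forall>a. act (torus_mult s t) a = act s (act t a)) \<and>
     (\<forall>a. \<exists>W. finite_dim_subrep n act W \<and> a \<in> W) \<and>
     (\<forall>W. finite_dim_subrep n act W \<longrightarrow>
        (\<forall>w\<in>W. \<forall>\<phi>. Vector_Spaces.linear scaleC (*) \<phi> \<longrightarrow> torus_regular n (\<lambda>t. \<phi> (act t w))))"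

text \<open>
  \<open>b\<close> is the derivative at \<open>s = 0\<close> of \<open>exp(sx) \<cdot> a\<close>.  For a locally finite action this curve
  lies in a finite-dimensional space, where the derivative may be taken after applying
  linear functionals.
\<close>

definition torus_differential ::
    "nat \<Rightarrow> ((nat \<Rightarrow> complex) \<Rightarrow> 'a :: complex_vector \<Rightarrow> 'a) \<Rightarrow> (nat \<Rightarrow> complex) \<Rightarrow> 'a \<Rightarrow> 'a \<Rightarrow> bool" where
  "torus_differential n act x a b \<longleftrightarrow>
     (\<forall>\<phi>. Vector_Spaces.linear scaleC (*) \<phi> \<longrightarrow>
        ((\<lambda>s. \<phi> (act (torus_exp n (\<lambda>i. s * x i)) a)) has_field_derivative \<phi> b) (at 0))"

text \<open>
  Since \<open>T\<close> is commutative, its adjoint action on \<open>\<tt>\<close>, hence on \<open>U(\<tt>)\<close>, is trivial; so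
  equivariance of \<open>\<iota>\<close> says that its values are fixed by \<open>T\<close>.  Each \<open>act t\<close> is an
  automorphism, with inverse \<open>act\<close> of the inverse of \<open>t\<close>.
\<close>

locale generalized_pair =
  fixes n :: nat
    and coord :: "'g :: complex_lie_algebra \<Rightarrow> nat \<Rightarrow> complex"
    and act :: "(nat \<Rightarrow> complex) \<Rightarrow> 'a :: complex_algebra_1 \<Rightarrow> 'a"
    and \<iota> :: "'g uea \<Rightarrow> 'a"
  assumes lie_algebra: "torus_lie_algebra n coord"
    and rational: "rational_torus_action n act"
    and automorphism: "t \<in> torus n \<Longrightarrow> complex_algebra_hom (act t)"
    and iota_hom: "complex_algebra_hom \<iota>"
    and iota_equivariant: "t \<in> torus n \<Longrightarrow> act t (\<iota> u) = \<iota> u"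
    and differential:
      "torus_differential n act (coord x) a (\<iota> (uea_of x) * a - a * \<iota> (uea_of x))"

definition countable_dimension :: "'a :: complex_vector itself \<Rightarrow> bool" where
  "countable_dimension _ \<longleftrightarrow>
     (\<exists>B :: 'a set. countable B \<and> complex_vector.independent B \<and> complex_vector.span B = UNIV)"


section \<open>Modules, associated primes and direct sums\<close>

text \<open>
  Over a complex algebra the scalars act on a module through \<open>c *\<^sub>C 1\<close>, so no separate
  complex structure on \<open>'v\<close> is needed.
\<close>

definition left_module :: "('r :: ring_1 \<Rightarrow> 'v :: ab_group_add \<Rightarrow> 'v) \<Rightarrow> bool" where
  "left_module m \<longleftrightarrow>
     (\<forall>r v w. m r (v + w) = m r v + m r w) \<and> (\<forall>r s v. m (r + s) v = m r v + m s v) \<and>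
     (\<forall>r s v. m (r * s) v = m r (m s v)) \<and> (\<forall>v. m 1 v = v)"

definition is_submodule :: "('r :: ring_1 \<Rightarrow> 'v :: ab_group_add \<Rightarrow> 'v) \<Rightarrow> 'v set \<Rightarrow> bool" where
  "is_submodule m W \<longleftrightarrow> 0 \<in> W \<and> (\<forall>v\<in>W. \<forall>w\<in>W. v + w \<in> W) \<and> (\<forall>r. \<forall>w\<in>W. m r w \<in> W)"

definition irreducible_module :: "('r :: ring_1 \<Rightarrow> 'v :: ab_group_add \<Rightarrow> 'v) \<Rightarrow> bool" where
  "irreducible_module m \<longleftrightarrow>
     left_module m \<and> (UNIV :: 'v set) \<noteq> {0} \<and> (\<forall>W. is_submodule m W \<longrightarrow> W = {0} \<or> W = UNIV)"

definition annihilator :: "('r :: ring_1 \<Rightarrow> 'v :: ab_group_add \<Rightarrow> 'v) \<Rightarrow> 'v \<Rightarrow> 'r set" where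
  "annihilator m v = {r. m r v = 0}"

definition associated_primes :: "('r :: ring_1 \<Rightarrow> 'v :: ab_group_add \<Rightarrow> 'v) \<Rightarrow> 'r set set" where
  "associated_primes m = {P. prime_ideal P \<and> (\<exists>v. P = annihilator m v)}"

definition killed_by :: "('r :: ring_1 \<Rightarrow> 'v :: ab_group_add \<Rightarrow> 'v) \<Rightarrow> 'r set \<Rightarrow> 'v set" where
  "killed_by m P = {v. \<forall>p\<in>P. m p v = 0}"

definition is_direct_sum ::
    "('r :: ring_1 \<Rightarrow> 'v :: ab_group_add \<Rightarrow> 'v) \<Rightarrow> 'i set \<Rightarrow> ('i \<Rightarrow> 'v set) \<Rightarrow> bool" where
  "is_direct_sum m I M \<longleftrightarrow>
     (\<forall>i\<in>I. is_submodule m (M i)) \<and>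
     (\<forall>v. \<exists>!f. finite {i. f i \<noteq> 0} \<and> {i. f i \<noteq> 0} \<subseteq> I \<and> (\<forall>i\<in>I. f i \<in> M i) \<and>
        v = (\<Sum>i | f i \<noteq> 0. f i))"

end

theory Submission
  imports Defs
begin

text \<open>
  Write \<open>U\<close> for the enveloping algebra of \<open>\<tt>\<close>, a polynomial ring in \<open>n\<close> variables.  Two facts carry
  the proof.

  The first is that \<open>\<A>\<close> is spanned by weight vectors (\<open>span_weight_vectors\<close>): the action of the torus is
  a sum of characters, and by the condition on the differential an eigenvector \<open>a\<close> of the torus satisfies
  \<open>[\<iota> x, a] = \<alpha>(x) a\<close> for a linear form \<open>\<alpha>\<close>.  Consequently \<open>\<iota> u a = a \<iota> (shift \<alpha> u)\<close>, where
  \<open>shift \<alpha>\<close> is the automorphism \<open>x \<mapsto> x + \<alpha>(x)\<close> of \<open>U\<close>, so \<open>a\<close> maps \<open>V\<^sup>P\<close> into \<open>V\<^sup>Q\<close>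
  for the translate \<open>Q\<close> of \<open>P\<close> by \<open>\<alpha>\<close>.  Therefore the sum of all \<open>V\<^sup>Q\<close>, with \<open>Q\<close> in the orbit of \<open>P\<close>
  under translations, is an \<open>\<A>\<close>-submodule, and by irreducibility it is \<open>V\<close> as soon as \<open>V\<^sup>P \<noteq> 0\<close>
  (\<open>orbit_sum_UNIV\<close>).

  The second is that \<open>U\<close> is noetherian.  It follows that every nonzero vector has a multiple whose
  annihilator is prime, and that a translate of \<open>P\<close> contained in \<open>P\<close> is equal to \<open>P\<close>
  (\<open>translate_eq_if_subset\<close>).

  Let \<open>P\<close> and \<open>R\<close> be associated primes.  A vector with annihilator \<open>P\<close> is a sum of vectors killed by
  translates of \<open>R\<close>, so the prime \<open>P\<close> contains one of these translates.  Applied to an associated prime \<open>R\<close>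
  above the annihilator of a nonzero vector \<open>x \<in> V\<^sup>Q\<close>, where \<open>Q\<close> is a translate of \<open>P\<close>, this gives a
  translate of \<open>R\<close> inside \<open>Q \<subseteq> Ann(x) \<subseteq> R\<close>, and then all of them are equal
  (\<open>annihilator_eq_translate\<close>).  Hence the orbit of \<open>P\<close> contributes to \<open>V\<close> only associated primes, which
  proves that \<open>V\<close> is the sum of the \<open>V\<^sup>P\<close>; distinct associated primes are incomparable; and a nonzero
  vector of \<open>V\<^sup>P\<close> has annihilator exactly \<open>P\<close>.  The last two properties make the sum direct, because
  an element of \<open>P\<close> outside \<open>Q\<close> kills \<open>V\<^sup>P\<close> and acts injectively on \<open>V\<^sup>Q\<close>.
\<close>

section \<open>Hilbert's basis theorem\<close>

definition subring_1 :: "'r :: ring_1 set \<Rightarrow> bool" where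
  "subring_1 S \<longleftrightarrow> 1 \<in> S \<and> (\<forall>x\<in>S. - x \<in> S) \<and> (\<forall>x\<in>S. \<forall>y\<in>S. x + y \<in> S \<and> x * y \<in> S)"

definition left_ideal_of :: "'r :: ring_1 set \<Rightarrow> 'r set \<Rightarrow> bool" where
  "left_ideal_of S I \<longleftrightarrow> I \<subseteq> S \<and> 0 \<in> I \<and> (\<forall>x\<in>I. \<forall>y\<in>I. x + y \<in> I) \<and> (\<forall>s\<in>S. \<forall>x\<in>I. s * x \<in> I)"

text \<open>
  The ascending chain condition is stated for a subset \<open>S\<close> of a ring because the basis theorem below
  is iterated along a tower of subrings of one and the same algebra.
\<close>

definition noetherian :: "'r :: ring_1 set \<Rightarrow> bool" where
  "noetherian S \<longleftrightarrow>
     (\<forall>I. (\<forall>k. left_ideal_of S (I k)) \<and> (\<forall>k. I k \<subseteq> I (Suc k)) \<longrightarrow> (\<exists>N. \<forall>k\<ge>N. I k = I N))"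

lemma noetherianD:
  assumes "noetherian S" "\<And>k. left_ideal_of S (I k)" "\<And>k. I k \<subseteq> I (Suc k)"
  obtains N where "\<And>k. k \<ge> N \<Longrightarrow> I k = I N"
  using assms unfolding noetherian_def by meson

lemma subring_1_zero: "subring_1 S \<Longrightarrow> 0 \<in> S"
  unfolding subring_1_def by (metis add.right_inverse)

lemma left_ideal_of_diff:
  assumes "subring_1 S" "left_ideal_of S I" "x \<in> I" "y \<in> I"
  shows "x - y \<in> I"
proof -
  have "- 1 \<in> S" using assms(1) by (simp add: subring_1_def)
  hence "- 1 * y \<in> I" using assms unfolding left_ideal_of_def by blast
  hence "x + - 1 * y \<in> I" using assms unfolding left_ideal_of_def by blast
  thus ?thesis by simp
qed

text \<open>
  Values at \<open>x\<close> of the polynomials of degree less than \<open>d\<close> with left coefficients in \<open>S\<close>.  Since \<open>x\<close>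
  need not be transcendental over \<open>S\<close>, an element may have several such expressions.
\<close>

primrec polys_below :: "'r :: ring_1 set \<Rightarrow> 'r \<Rightarrow> nat \<Rightarrow> 'r set" where
  "polys_below S x 0 = {0}"
| "polys_below S x (Suc d) = {c * x ^ d + r | c r. c \<in> S \<and> r \<in> polys_below S x d}"

definition adjoin :: "'r :: ring_1 set \<Rightarrow> 'r \<Rightarrow> 'r set" where
  "adjoin S x = (\<Union>d. polys_below S x d)"

text \<open>
  Zero is not excluded, so that this set is an ideal, and the same element of \<open>J\<close> may contribute several
  coefficients.
\<close>

definition leading_coeffs :: "'r :: ring_1 set \<Rightarrow> 'r \<Rightarrow> 'r set \<Rightarrow> nat \<Rightarrow> 'r set" where
  "leading_coeffs S x J d = {c \<in> S. \<exists>r\<in>polys_below S x d. c * x ^ d + r \<in> J}"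

context
  fixes S :: "'r :: ring_1 set" and x :: 'r
  assumes S: "subring_1 S" and comm: "\<And>s. s \<in> S \<Longrightarrow> s * x = x * s"
begin

lemma coefficients_closed: "a \<in> S \<Longrightarrow> b \<in> S \<Longrightarrow> a + b \<in> S" "a \<in> S \<Longrightarrow> b \<in> S \<Longrightarrow> a * b \<in> S"
  "a \<in> S \<Longrightarrow> - a \<in> S" "1 \<in> S" "0 \<in> S"
  using S subring_1_zero[OF S] by (auto simp: subring_1_def)

lemma polys_below_SucI:
  "c \<in> S \<Longrightarrow> r \<in> polys_below S x d \<Longrightarrow> c * x ^ d + r \<in> polys_below S x (Suc d)"
  by auto

lemma polys_below_SucE:
  assumes "p \<in> polys_below S x (Suc d)"
  obtains c r where "p = c * x ^ d + r" "c \<in> S" "r \<in> polys_below S x d"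
  using assms by auto

lemma polys_below_zero: "0 \<in> polys_below S x d"
proof (induction d)
  case (Suc d)
  show ?case using polys_below_SucI[OF coefficients_closed(5) Suc] by simp
qed simp

lemma polys_below_Suc: "p \<in> polys_below S x d \<Longrightarrow> p \<in> polys_below S x (Suc d)"
  using polys_below_SucI[OF coefficients_closed(5)] by fastforce

lemma polys_below_mono: "d \<le> e \<Longrightarrow> p \<in> polys_below S x d \<Longrightarrow> p \<in> polys_below S x e"
  by (induction e rule: dec_induct) (auto simp del: polys_below.simps intro: polys_below_Suc)

lemma polys_below_add:
  "p \<in> polys_below S x d \<Longrightarrow> q \<in> polys_below S x d \<Longrightarrow> p + q \<in> polys_below S x d"
proof (induction d arbitrary: p q)
  case (Suc d)
  obtain a r where p: "p = a * x ^ d + r" "a \<in> S" "r \<in> polys_below S x d"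
    using Suc.prems(1) by (rule polys_below_SucE)
  obtain b s where q: "q = b * x ^ d + s" "b \<in> S" "s \<in> polys_below S x d"
    using Suc.prems(2) by (rule polys_below_SucE)
  have "p + q = (a + b) * x ^ d + (r + s)" using p(1) q(1) by (simp add: algebra_simps)
  thus ?case using polys_below_SucI[OF coefficients_closed(1)[OF p(2) q(2)] Suc.IH[OF p(3) q(3)]] by simp
qed simp

lemma polys_below_smult:
  "c \<in> S \<Longrightarrow> p \<in> polys_below S x d \<Longrightarrow> c * p \<in> polys_below S x d"
proof (induction d arbitrary: p)
  case (Suc d)
  obtain a r where p: "p = a * x ^ d + r" "a \<in> S" "r \<in> polys_below S x d"
    using Suc.prems(2) by (rule polys_below_SucE)
  have "c * p = (c * a) * x ^ d + c * r" using p(1) by (simp add: algebra_simps)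
  thus ?case
    using polys_below_SucI[OF coefficients_closed(2)[OF Suc.prems(1) p(2)] Suc.IH[OF Suc.prems(1) p(3)]] by simp
qed simp

lemma polys_below_shift:
  "p \<in> polys_below S x d \<Longrightarrow> x * p \<in> polys_below S x (Suc d)"
proof (induction d arbitrary: p)
  case 0
  thus ?case using polys_below_zero by (simp del: polys_below.simps(2))
next
  case (Suc d)
  obtain a r where p: "p = a * x ^ d + r" "a \<in> S" "r \<in> polys_below S x d"
    using Suc.prems by (rule polys_below_SucE)
  have "x * p = x * a * x ^ d + x * r" using p(1) by (simp add: algebra_simps)
  also have "x * a * x ^ d = a * x ^ Suc d" using comm[OF p(2)] by (simp add: mult.assoc[symmetric])
  finally have "x * p = a * x ^ Suc d + x * r" .
  moreover have "x * r \<in> polys_below S x (Suc d)" using Suc.IH p(3) .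
  ultimately show ?case using polys_below_SucI[OF p(2)] by metis
qed

lemma adjoin_add: "p \<in> adjoin S x \<Longrightarrow> q \<in> adjoin S x \<Longrightarrow> p + q \<in> adjoin S x"
proof -
  assume "p \<in> adjoin S x" "q \<in> adjoin S x"
  then obtain d e where "p \<in> polys_below S x d" "q \<in> polys_below S x e" by (auto simp: adjoin_def)
  hence "p + q \<in> polys_below S x (max d e)"
    by (meson max.cobounded1 max.cobounded2 polys_below_add polys_below_mono)
  thus ?thesis by (auto simp: adjoin_def)
qed

lemma adjoin_smult: "c \<in> S \<Longrightarrow> p \<in> adjoin S x \<Longrightarrow> c * p \<in> adjoin S x"
  unfolding adjoin_def using polys_below_smult by blast

lemma adjoin_power_mult: "p \<in> adjoin S x \<Longrightarrow> x ^ k * p \<in> adjoin S x"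
proof (induction k)
  case (Suc k)
  then obtain d where "x ^ k * p \<in> polys_below S x d" unfolding adjoin_def by blast
  hence "x * (x ^ k * p) \<in> polys_below S x (Suc d)" by (rule polys_below_shift)
  thus ?case unfolding adjoin_def by (metis UN_I UNIV_I mult.assoc power_Suc)
qed simp

lemma coefficients_subset_adjoin: "S \<subseteq> adjoin S x"
proof
  fix c assume "c \<in> S"
  hence "c \<in> polys_below S x (Suc 0)" using polys_below_SucI[of c 0 0] by simp
  thus "c \<in> adjoin S x" unfolding adjoin_def by blast
qed

lemma generator_in_adjoin: "x \<in> adjoin S x"
  using adjoin_power_mult[of 1 1] coefficients_subset_adjoin coefficients_closed(4) by force

lemma subring_1_adjoin: "subring_1 (adjoin S x)"
proof -
  have mult: "p * q \<in> adjoin S x" if "p \<in> polys_below S x d" "q \<in> adjoin S x" for p q d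
    using that(1)
  proof (induction d arbitrary: p)
    case 0
    thus ?case using coefficients_subset_adjoin coefficients_closed by auto
  next
    case (Suc d)
    obtain c r where p: "p = c * x ^ d + r" "c \<in> S" "r \<in> polys_below S x d"
      using Suc.prems by (rule polys_below_SucE)
    have "c * (x ^ d * q) \<in> adjoin S x" using p(2) that(2) adjoin_smult adjoin_power_mult by blast
    moreover have "r * q \<in> adjoin S x" using Suc.IH p(3) .
    ultimately show ?case using adjoin_add p(1) by (simp add: algebra_simps)
  qed
  have "p * q \<in> adjoin S x" if "p \<in> adjoin S x" "q \<in> adjoin S x" for p q
    using that mult unfolding adjoin_def by blast
  moreover have "- p \<in> adjoin S x" if "p \<in> adjoin S x" for p
    using adjoin_smult[of "- 1" p] that coefficients_closed by simp
  ultimately show ?thesis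
    using adjoin_add coefficients_subset_adjoin coefficients_closed(4) unfolding subring_1_def by blast
qed

lemma left_ideal_leading_coeffs:
  assumes "left_ideal_of (adjoin S x) J"
  shows "left_ideal_of S (leading_coeffs S x J d)"
proof -
  have "a + b \<in> leading_coeffs S x J d"
    if ab: "a \<in> leading_coeffs S x J d" "b \<in> leading_coeffs S x J d" for a b
  proof -
    obtain r s where rs: "r \<in> polys_below S x d" "a * x ^ d + r \<in> J" "s \<in> polys_below S x d" "b * x ^ d + s \<in> J"
      using ab unfolding leading_coeffs_def by blast
    hence "(a * x ^ d + r) + (b * x ^ d + s) \<in> J" using assms unfolding left_ideal_of_def by blast
    hence "(a + b) * x ^ d + (r + s) \<in> J" by (simp add: algebra_simps)
    thus ?thesis using rs polys_below_add that coefficients_closed unfolding leading_coeffs_def by blast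
  qed
  moreover have "c * a \<in> leading_coeffs S x J d" if ca: "c \<in> S" "a \<in> leading_coeffs S x J d" for a c
  proof -
    obtain r where r: "r \<in> polys_below S x d" "a * x ^ d + r \<in> J"
      using ca unfolding leading_coeffs_def by blast
    hence "c * (a * x ^ d + r) \<in> J"
      using assms that(1) coefficients_subset_adjoin unfolding left_ideal_of_def by blast
    hence "(c * a) * x ^ d + c * r \<in> J" by (simp add: algebra_simps)
    thus ?thesis using r polys_below_smult that coefficients_closed unfolding leading_coeffs_def by blast
  qed
  moreover have "0 * x ^ d + 0 \<in> J" using assms unfolding left_ideal_of_def by simp
  hence "0 \<in> leading_coeffs S x J d"
    using polys_below_zero coefficients_closed(5) unfolding leading_coeffs_def by blast
  ultimately show ?thesis unfolding left_ideal_of_def leading_coeffs_def by blast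
qed

lemma leading_coeffs_Suc:
  assumes "left_ideal_of (adjoin S x) J"
  shows "leading_coeffs S x J d \<subseteq> leading_coeffs S x J (Suc d)"
proof
  fix c assume c: "c \<in> leading_coeffs S x J d"
  then obtain r where r: "r \<in> polys_below S x d" "c * x ^ d + r \<in> J" and "c \<in> S"
    unfolding leading_coeffs_def by blast
  hence "x * (c * x ^ d + r) \<in> J"
    using assms generator_in_adjoin unfolding left_ideal_of_def by blast
  also have "x * (c * x ^ d + r) = x * c * x ^ d + x * r" by (simp add: algebra_simps)
  also have "x * c * x ^ d = c * x ^ Suc d" using comm[OF \<open>c \<in> S\<close>] by (simp add: mult.assoc[symmetric])
  finally have "c * x ^ Suc d + x * r \<in> J" .
  thus "c \<in> leading_coeffs S x J (Suc d)"
    using polys_below_shift[OF r(1)] \<open>c \<in> S\<close> unfolding leading_coeffs_def by blast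
qed

lemma leading_coeffs_mono: "J \<subseteq> J' \<Longrightarrow> leading_coeffs S x J d \<subseteq> leading_coeffs S x J' d"
  unfolding leading_coeffs_def by blast

text \<open>
  Subtracting from an element of \<open>J'\<close> an element of \<open>J\<close> with the same leading coefficient lowers its
  degree, and the difference is still in \<open>J'\<close>.
\<close>

lemma eq_if_leading_coeffs_eq:
  assumes J: "left_ideal_of (adjoin S x) J" and J': "left_ideal_of (adjoin S x) J'"
    and sub: "J \<subseteq> J'" and eq: "\<And>d. leading_coeffs S x J d = leading_coeffs S x J' d"
  shows "J = J'"
proof -
  have "p \<in> J" if "p \<in> polys_below S x d" "p \<in> J'" for p d
    using that
  proof (induction d arbitrary: p)
    case 0
    thus ?case using J unfolding left_ideal_of_def by simp
  next
    case (Suc d)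
    obtain c r where p: "p = c * x ^ d + r" "c \<in> S" "r \<in> polys_below S x d"
      using Suc.prems(1) by (rule polys_below_SucE)
    hence "c \<in> leading_coeffs S x J d" using Suc.prems(2) eq unfolding leading_coeffs_def by blast
    then obtain s where s: "s \<in> polys_below S x d" "c * x ^ d + s \<in> J"
      unfolding leading_coeffs_def by blast
    have "p - (c * x ^ d + s) \<in> J'"
      using left_ideal_of_diff[OF subring_1_adjoin J'] Suc.prems(2) s(2) sub by blast
    moreover have "p - (c * x ^ d + s) = r + - 1 * s" using p(1) by simp
    moreover have "r + - 1 * s \<in> polys_below S x d"
      by (intro polys_below_add polys_below_smult coefficients_closed(3,4) p(3) s(1))
    ultimately have "p - (c * x ^ d + s) \<in> J" using Suc.IH by metis
    hence "(p - (c * x ^ d + s)) + (c * x ^ d + s) \<in> J"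
      using s(2) J unfolding left_ideal_of_def by blast
    thus ?case by simp
  qed
  thus ?thesis using sub J' unfolding left_ideal_of_def adjoin_def by blast
qed

text \<open>
  The sets \<open>leading_coeffs S x (J k) d\<close> grow with both \<open>k\<close> and \<open>d\<close>.  The diagonal \<open>k = d\<close> becomes
  constant from some \<open>N\<close> on, and by monotonicity this settles all \<open>d \<ge> N\<close> at once; for each of the
  finitely many \<open>d < N\<close> the chain in \<open>k\<close> is treated separately.
\<close>

theorem noetherian_adjoin:
  assumes "noetherian S"
  shows "noetherian (adjoin S x)"
  unfolding noetherian_def
proof (intro allI impI, elim conjE)
  fix J assume J: "\<forall>k. left_ideal_of (adjoin S x) (J k)" and up: "\<forall>k. J k \<subseteq> J (Suc k)"
  let ?L = "\<lambda>k d. leading_coeffs S x (J k) d"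
  have J_mono: "J k \<subseteq> J l" if "k \<le> l" for k l using up that by (simp add: lift_Suc_mono_le)
  have L_mono: "?L k d \<subseteq> ?L l e" if "k \<le> l" "d \<le> e" for k l d e
  proof -
    have "?L k d \<subseteq> ?L k e" using leading_coeffs_Suc J that(2) by (simp add: lift_Suc_mono_le)
    thus ?thesis using leading_coeffs_mono[OF J_mono[OF that(1)]] by blast
  qed
  obtain N where N: "\<And>k. k \<ge> N \<Longrightarrow> ?L k k = ?L N N"
    using noetherianD[OF assms, of "\<lambda>k. ?L k k"] left_ideal_leading_coeffs J L_mono by (metis le_SucI order_refl)
  have "\<exists>M. \<forall>k\<ge>M. ?L k d = ?L M d" for d
    using noetherianD[OF assms, of "\<lambda>k. ?L k d"] left_ideal_leading_coeffs J L_mono by (metis le_SucI order_refl)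
  then obtain M where M: "\<And>d k. k \<ge> M d \<Longrightarrow> ?L k d = ?L (M d) d" by metis
  define K where "K = N + (\<Sum>d<N. M d)"
  have "?L k d = ?L K d" if "k \<ge> K" for k d
  proof (cases "d < N")
    case True
    hence "M d \<le> K" unfolding K_def using member_le_sum[of d "{..<N}" M] by force
    thus ?thesis using M that by (metis order_trans)
  next
    case False
    have "?L l d = ?L N N" if "l \<ge> K" for l
    proof
      show "?L N N \<subseteq> ?L l d" using L_mono that False by (simp add: K_def)
      have "?L l d \<subseteq> ?L (max l d) (max l d)" using L_mono by simp
      thus "?L l d \<subseteq> ?L N N" using N[of "max l d"] False by simp
    qed
    thus ?thesis using that by simp
  qed
  hence "J k = J K" if "k \<ge> K" for k
    using eq_if_leading_coeffs_eq[of "J K" "J k"] J J_mono that by metis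
  thus "\<exists>N. \<forall>k\<ge>N. J k = J N" by blast
qed

end

lemma noetherian_maximal:
  assumes "noetherian S" "F \<noteq> {}" "\<And>I. I \<in> F \<Longrightarrow> left_ideal_of S I"
  obtains I where "I \<in> F" "\<And>J. J \<in> F \<Longrightarrow> I \<subseteq> J \<Longrightarrow> J = I"
proof -
  let ?R = "{(J, I). I \<in> F \<and> J \<in> F \<and> I \<subset> J}"
  have wf: "wf ?R"
    unfolding wf_iff_no_infinite_down_chain
  proof
    assume "\<exists>f. \<forall>i. (f (Suc i), f i) \<in> ?R"
    then obtain f where "\<forall>i. f i \<in> F \<and> f i \<subset> f (Suc i)" by blast
    hence f: "\<And>i. f i \<in> F" "\<And>i. f i \<subset> f (Suc i)" by auto
    then obtain N where N: "\<And>k. k \<ge> N \<Longrightarrow> f k = f N"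
      using noetherianD[OF assms(1), of f] assms(3) by (metis psubsetE)
    have "f (Suc N) = f N" by (rule N) simp
    thus False using f(2)[of N] by simp
  qed
  obtain I0 where "I0 \<in> F" using assms(2) by blast
  show thesis
  proof (rule wfE_min[OF wf \<open>I0 \<in> F\<close>])
    fix I assume "I \<in> F" "\<And>J. (J, I) \<in> ?R \<Longrightarrow> J \<notin> F"
    thus thesis using that[of I] by blast
  qed
qed

section \<open>Enveloping algebras and their shift automorphisms\<close>

lemma complex_algebra_homD:
  assumes "complex_algebra_hom F"
  shows "F (u + w) = F u + F w" "F (c *\<^sub>C u) = c *\<^sub>C F u" "F 1 = 1" "F (u * w) = F u * F w" "F 0 = 0"
    "F (u - w) = F u - F w"
proof -
  interpret F: Vector_Spaces.linear scaleC scaleC F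
    using assms unfolding complex_algebra_hom_def by blast
  show "F (u + w) = F u + F w" "F (c *\<^sub>C u) = c *\<^sub>C F u" "F 0 = 0" "F (u - w) = F u - F w"
    by (rule F.add F.scale F.zero F.diff)+
  show "F 1 = 1" "F (u * w) = F u * F w"
    using assms unfolding complex_algebra_hom_def by blast+
qed

lemma complex_algebra_homI:
  assumes "\<And>u w. F (u + w) = F u + F w" "\<And>c u. F (c *\<^sub>C u) = c *\<^sub>C F u" "F 1 = 1"
    "\<And>u w. F (u * w) = F u * F w"
  shows "complex_algebra_hom F"
  unfolding complex_algebra_hom_def
  by (intro conjI allI assms) (unfold_locales, simp_all add: assms scaleC_add_right scaleC_add_left scaleC_scaleC scaleC_one)

lemma complex_algebra_hom_comp:
  "complex_algebra_hom F \<Longrightarrow> complex_algebra_hom G \<Longrightarrow> complex_algebra_hom (F \<circ> G)"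
  by (rule complex_algebra_homI) (simp_all add: complex_algebra_homD)

lemma complex_algebra_hom_id: "complex_algebra_hom id"
  by (rule complex_algebra_homI) simp_all

lemma scaleC_one_mult:
  fixes u :: "'a :: complex_algebra_1"
  shows "(c *\<^sub>C 1) * u = c *\<^sub>C u" "u * (c *\<^sub>C 1) = c *\<^sub>C u"
  by (simp_all add: mult_scaleC_left mult_scaleC_right)

lemma single_sum_induct [case_names single add]:
  assumes "\<And>w c. P (Poly_Mapping.single w c)" "\<And>f g. P f \<Longrightarrow> P g \<Longrightarrow> P (f + g)"
  shows "P (f :: 'g free_algebra)"
proof -
  have "P (\<Sum>w\<in>K. Poly_Mapping.single w (Poly_Mapping.lookup f w))" if "finite K" for K
    using that
  proof (induction K)
    case empty
    show ?case using assms(1)[of 0 0] by simp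
  qed (simp add: assms)
  moreover have "(\<Sum>w\<in>Poly_Mapping.keys f. Poly_Mapping.single w (Poly_Mapping.lookup f w)) = f"
    by (rule poly_mapping_eqI) (simp add: lookup_sum lookup_single when_def in_keys_iff)
  ultimately show ?thesis by (metis finite_keys)
qed

lemma single_Word_Cons:
  "Poly_Mapping.single (Word (x # xs)) c = letter x * Poly_Mapping.single (Word xs) (c :: complex)"
  by (simp add: letter_def mult_single)

lemma uea_induct [case_names one letter add scale]:
  assumes one: "P 1"
    and letter: "\<And>x u. P u \<Longrightarrow> P (uea_of x * u)"
    and add: "\<And>u w. P u \<Longrightarrow> P w \<Longrightarrow> P (u + w)"
    and scale: "\<And>c u. P u \<Longrightarrow> P (c *\<^sub>C u)"
  shows "P (u :: 'g :: complex_lie_algebra uea)"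
proof -
  have "P (abs_uea (Poly_Mapping.single (Word xs) c))" for xs :: "'g list" and c
  proof (induction xs)
    case Nil
    have "Poly_Mapping.single (Word []) c = free_const c * (1 :: 'g free_algebra)"
      by (simp add: zero_word_monoid_def)
    hence "abs_uea (Poly_Mapping.single (Word []) c) = c *\<^sub>C (1 :: 'g uea)"
      by (simp add: one_uea.abs_eq scaleC_uea.abs_eq)
    thus ?case using one scale by simp
  next
    case (Cons x xs)
    thus ?case using letter by (simp add: single_Word_Cons times_uea.abs_eq[symmetric] uea_of.abs_eq[symmetric])
  qed
  hence "P (abs_uea (Poly_Mapping.single w c))" for w :: "'g word_monoid" and c by (cases w) simp
  hence "P (abs_uea f)" for f :: "'g free_algebra"
    by (induction f rule: single_sum_induct) (simp_all add: add plus_uea.abs_eq[symmetric])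
  thus ?thesis by (rule uea.abs_induct)
qed

lemma uea_hom_eqI:
  fixes F G :: "'g :: complex_lie_algebra uea \<Rightarrow> 'b :: complex_algebra_1"
  assumes "complex_algebra_hom F" "complex_algebra_hom G" "\<And>x. F (uea_of x) = G (uea_of x)"
  shows "F = G"
proof
  fix u show "F u = G u"
    by (induction u rule: uea_induct) (simp_all add: assms complex_algebra_homD)
qed

primrec eval_word :: "('g \<Rightarrow> 'b :: ring_1) \<Rightarrow> 'g word_monoid \<Rightarrow> 'b" where
  "eval_word h (Word xs) = prod_list (map h xs)"

lemma eval_word_zero [simp]: "eval_word h 0 = 1"
  by (simp add: zero_word_monoid_def)

definition eval_free :: "('g \<Rightarrow> 'b :: complex_algebra_1) \<Rightarrow> 'g free_algebra \<Rightarrow> 'b" where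
  "eval_free h f = Sum_any (\<lambda>w. Poly_Mapping.lookup f w *\<^sub>C eval_word h w)"

lemma eval_free_single [simp]: "eval_free h (Poly_Mapping.single w c) = c *\<^sub>C eval_word h w"
proof -
  have "Poly_Mapping.lookup (Poly_Mapping.single w c) v *\<^sub>C eval_word h v
      = (c *\<^sub>C eval_word h v when v = w)" for v
    by (simp add: lookup_single when_def)
  thus ?thesis by (simp add: eval_free_def)
qed

lemma eval_free_add [simp]: "eval_free h (f + g) = eval_free h f + eval_free h g"
proof -
  have "finite {w. Poly_Mapping.lookup f w *\<^sub>C eval_word h w \<noteq> 0}" for f
    by (rule finite_subset[OF _ finite_keys[of f]]) (auto simp: in_keys_iff)
  thus ?thesis by (simp add: eval_free_def lookup_add scaleC_add_left Sum_any.distrib)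
qed

lemma eval_free_diff [simp]: "eval_free h (f - g) = eval_free h f - eval_free h g"
  using eval_free_add[of h "f - g" g] by simp

lemma eval_word_plus: "eval_word h (v + w) = eval_word h v * eval_word h w"
  by (cases v; cases w) simp

lemma eval_free_mult [simp]: "eval_free h (f * g) = eval_free h f * eval_free h g"
proof (induction f rule: single_sum_induct)
  case (single v c)
  show ?case
    by (induction g rule: single_sum_induct)
       (simp_all add: mult_single eval_word_plus mult_scaleC_left mult_scaleC_right scaleC_scaleC
          distrib_left)
qed (simp add: distrib_right)

text \<open>
  The map \<open>h\<close> extends to the free algebra by evaluation of words; the kernel is a two-sided ideal that
  contains the defining relations, hence the extension factors through the enveloping algebra.
\<close>

lemma uea_universal_property:
  fixes h :: "'g :: complex_lie_algebra \<Rightarrow> 'b :: complex_algebra_1"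
  assumes "\<And>x y. h (x + y) = h x + h y" "\<And>c x. h (c *\<^sub>C x) = c *\<^sub>C h x"
    and "\<And>x y. h x * h y - h y * h x = h (lie_bracket x y)"
  obtains F where "complex_algebra_hom F" "\<And>x. F (uea_of x) = h x"
proof -
  have letter: "eval_free h (letter x) = h x" for x by (simp add: letter_def)
  have const: "eval_free h (free_const c) = c *\<^sub>C 1" for c by simp
  let ?K = "{f. eval_free h f = 0}"
  have "eval_free h 0 = 0" using eval_free_add[of h 0 0] by simp
  hence "two_sided_ideal ?K" by (simp add: two_sided_ideal_def)
  moreover have "uea_relations \<subseteq> ?K"
    by (auto simp: uea_relations_def letter assms scaleC_one_mult)
  ultimately have "uea_ideal \<subseteq> ?K" unfolding uea_ideal_def by (rule hull_minimal[rotated])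
  hence eq: "eval_free h f = eval_free h g" if "f - g \<in> uea_ideal" for f g
    using that by auto
  define F where "F u = eval_free h (rep_uea u)" for u
  have F_abs: "F (abs_uea f) = eval_free h f" for f
    unfolding F_def using Quotient3_rep_abs[OF Quotient3_uea, of f] by (intro eq) (simp add: uea_ideal_zero)
  have "complex_algebra_hom F"
  proof (rule complex_algebra_homI)
    show "F (u + w) = F u + F w" for u w
      by (induction u rule: uea.abs_induct; induction w rule: uea.abs_induct)
         (simp add: plus_uea.abs_eq F_abs)
    show "F (c *\<^sub>C u) = c *\<^sub>C F u" for c u
      by (induction u rule: uea.abs_induct) (simp add: scaleC_uea.abs_eq F_abs scaleC_one_mult)
    show "F 1 = 1" using const[of 1] by (simp add: one_uea.abs_eq F_abs scaleC_one)
    show "F (u * w) = F u * F w" for u w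
      by (induction u rule: uea.abs_induct; induction w rule: uea.abs_induct)
         (simp add: times_uea.abs_eq F_abs)
  qed
  moreover have "F (uea_of x) = h x" for x by (simp add: uea_of.abs_eq F_abs letter)
  ultimately show thesis using that by blast
qed

lemma uea_of_add: "uea_of (x + y) = uea_of x + uea_of y"
  and uea_of_scale: "uea_of (c *\<^sub>C x) = c *\<^sub>C uea_of x"
  and uea_of_bracket: "uea_of x * uea_of y - uea_of y * uea_of x = uea_of (lie_bracket x y)"
proof -
  have "letter (x + y) - (letter x + letter y) \<in> uea_ideal"
    "letter (c *\<^sub>C x) - free_const c * letter x \<in> uea_ideal"
    "(letter x * letter y - letter y * letter x) - letter (lie_bracket x y) \<in> uea_ideal"
    by (rule subsetD[OF uea_relations_subset]; auto simp: uea_relations_def diff_diff_eq)+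
  thus "uea_of (x + y) = uea_of x + uea_of y" "uea_of (c *\<^sub>C x) = c *\<^sub>C uea_of x"
    "uea_of x * uea_of y - uea_of y * uea_of x = uea_of (lie_bracket x y)"
    by (simp_all add: uea_of.abs_eq plus_uea.abs_eq scaleC_uea.abs_eq times_uea.abs_eq minus_uea.abs_eq
        uea.abs_eq_iff)
qed

lemma uea_of_zero: "uea_of 0 = 0"
  using uea_of_add[of 0 0] by simp

text \<open>
  The scalars are a field, so a left ideal with a nonzero element is everything.
\<close>

lemma noetherian_scalars: "noetherian (range (\<lambda>c. c *\<^sub>C (1 :: 'a :: complex_algebra_1)))"
  unfolding noetherian_def
proof (intro allI impI, elim conjE)
  let ?S = "range (\<lambda>c. c *\<^sub>C (1 :: 'a))"
  fix I assume I: "\<forall>k. left_ideal_of ?S (I k)" and up: "\<forall>k. I k \<subseteq> I (Suc k)"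
  show "\<exists>N. \<forall>k\<ge>N. I k = I N"
  proof (cases "\<forall>k. I k \<subseteq> {0}")
    case True
    thus ?thesis using I unfolding left_ideal_of_def by blast
  next
    case False
    then obtain N c where c: "c *\<^sub>C 1 \<in> I N" "c *\<^sub>C 1 \<noteq> (0 :: 'a)"
      using I unfolding left_ideal_of_def by blast
    have "I k = ?S" if "k \<ge> N" for k
    proof
      show "I k \<subseteq> ?S" using I unfolding left_ideal_of_def by blast
      have ck: "c *\<^sub>C 1 \<in> I k" using c(1) that up lift_Suc_mono_le[of I N k] by blast
      have "d *\<^sub>C 1 \<in> I k" for d
      proof -
        have "(d / c) *\<^sub>C 1 * c *\<^sub>C 1 \<in> I k" using I ck unfolding left_ideal_of_def by blast
        moreover have "c \<noteq> 0" using c(2) by auto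
        ultimately show ?thesis by (simp add: scaleC_one_mult scaleC_scaleC)
      qed
      thus "?S \<subseteq> I k" by blast
    qed
    thus ?thesis by blast
  qed
qed

context
  assumes abelian: "\<And>x y :: 'g :: complex_lie_algebra. lie_bracket x y = 0"
begin

lemma uea_commute: "u * w = w * (u :: 'g uea)"
proof -
  have letters: "uea_of x * uea_of y = uea_of y * uea_of (x :: 'g)" for x y
    using uea_of_bracket[of x y] by (simp add: abelian uea_of_zero)
  have letters_central: "uea_of x * w = w * uea_of (x :: 'g)" for x w
  proof (induction w rule: uea_induct)
    case (letter y w)
    thus ?case using letters by (metis mult.assoc)
  qed (simp_all add: distrib_left distrib_right mult_scaleC_left mult_scaleC_right)
  show ?thesis
  proof (induction u rule: uea_induct)
    case (letter x u)
    have "uea_of x * u * w = uea_of x * w * u" using letter.IH by (simp add: mult.assoc)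
    also have "\<dots> = w * (uea_of x * u)" by (simp add: letters_central mult.assoc)
    finally show ?case .
  qed (simp_all add: distrib_left distrib_right mult_scaleC_left mult_scaleC_right)
qed

text \<open>
  The enveloping algebra is obtained from the scalars by adjoining finitely many elements that commute
  with everything.
\<close>

lemma noetherian_uea:
  fixes e :: "nat \<Rightarrow> 'g" and coord :: "'g \<Rightarrow> nat \<Rightarrow> complex"
  assumes span: "\<And>x. x = (\<Sum>i<n. coord x i *\<^sub>C e i)"
  shows "noetherian (UNIV :: 'g uea set)"
proof -
  let ?C = "range (\<lambda>c. c *\<^sub>C (1 :: 'g uea))"
  define S where "S k = rec_nat ?C (\<lambda>i R. adjoin R (uea_of (e i))) k" for k
  have S_simps: "S 0 = ?C" "S (Suc k) = adjoin (S k) (uea_of (e k))" for k by (simp_all add: S_def)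
  have "subring_1 ?C"
    unfolding subring_1_def
    by (auto simp: scaleC_one_mult scaleC_scaleC scaleC_add_left[symmetric]
        intro: range_eqI[of _ _ 1] range_eqI[of _ _ "- c" for c] simp flip: complex_vector.scale_minus_left
        simp: scaleC_one)
  hence S: "subring_1 (S k) \<and> noetherian (S k)" for k
    by (induction k)
       (auto simp: S_simps noetherian_scalars uea_commute intro!: subring_1_adjoin noetherian_adjoin)
  have adjoin: "S k \<subseteq> S (Suc k)" "uea_of (e k) \<in> S (Suc k)" for k
    using coefficients_subset_adjoin[of "S k" "uea_of (e k)"] generator_in_adjoin[of "S k" "uea_of (e k)"] S
      uea_commute by (auto simp: S_simps)
  have S_mono: "S k \<subseteq> S l" if "k \<le> l" for k l using adjoin that by (simp add: lift_Suc_mono_le)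
  have closed: "a + b \<in> S n" "a * b \<in> S n" if "a \<in> S n" "b \<in> S n" for a b
    using S that unfolding subring_1_def by blast+
  have scale: "c *\<^sub>C a \<in> S n" if "a \<in> S n" for c a
    using closed(2)[of "c *\<^sub>C 1" a] that S_mono[of 0 n] by (auto simp: S_simps scaleC_one_mult)
  have "uea_of x \<in> S n" for x
  proof -
    have "uea_of (\<Sum>i<m. coord x i *\<^sub>C e i) \<in> S n" if "m \<le> n" for m
      using that
    proof (induction m)
      case 0
      thus ?case using S subring_1_zero[of "S n"] by (simp add: uea_of_zero)
    next
      case (Suc m)
      have "uea_of (e m) \<in> S n" using adjoin(2)[of m] S_mono[of "Suc m" n] Suc.prems by blast
      thus ?case using Suc closed(1) scale by (simp add: uea_of_add uea_of_scale)
    qed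
    thus ?thesis using span[of x] by (metis order_refl)
  qed
  hence "u \<in> S n" for u
  proof (induction u rule: uea_induct)
    case one
    thus ?case using S unfolding subring_1_def by blast
  qed (use closed scale in auto)
  hence "S n = UNIV" by blast
  thus ?thesis using S by metis
qed

lemma shift_hom_exists:
  fixes \<alpha> :: "'g \<Rightarrow> complex"
  assumes "Vector_Spaces.linear scaleC (*) \<alpha>"
  shows "\<exists>F. complex_algebra_hom F \<and> (\<forall>x. F (uea_of x) = uea_of x + \<alpha> x *\<^sub>C 1)"
proof -
  interpret \<alpha>: Vector_Spaces.linear scaleC "(*)" \<alpha> by fact
  show ?thesis
  proof (rule uea_universal_property[of "\<lambda>x. uea_of x + \<alpha> x *\<^sub>C 1"])
    show "(uea_of x + \<alpha> x *\<^sub>C 1) * (uea_of y + \<alpha> y *\<^sub>C 1) - (uea_of y + \<alpha> y *\<^sub>C 1) * (uea_of x + \<alpha> x *\<^sub>C 1)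
        = uea_of (lie_bracket x y) + \<alpha> (lie_bracket x y) *\<^sub>C 1" for x y
      by (simp add: uea_commute abelian uea_of_zero \<alpha>.zero)
  qed (auto simp: uea_of_add uea_of_scale \<alpha>.add \<alpha>.scale scaleC_add_left scaleC_add_right scaleC_scaleC)
qed

end

text \<open>
  For abelian \<open>\<gg>\<close> the enveloping algebra is the algebra of polynomial functions on the dual of
  \<open>\<gg>\<close>, and \<open>shift \<alpha>\<close> is the pull-back along the translation by \<open>\<alpha>\<close>.
\<close>

definition shift :: "('g :: complex_lie_algebra \<Rightarrow> complex) \<Rightarrow> 'g uea \<Rightarrow> 'g uea" where
  "shift \<alpha> = (SOME F. complex_algebra_hom F \<and> (\<forall>x. F (uea_of x) = uea_of x + \<alpha> x *\<^sub>C 1))"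

context
  assumes abelian: "\<And>x y :: 'g :: complex_lie_algebra. lie_bracket x y = 0"
begin

lemma shift_hom:
  fixes \<alpha> :: "'g \<Rightarrow> complex"
  assumes "Vector_Spaces.linear scaleC (*) \<alpha>"
  shows "complex_algebra_hom (shift \<alpha>)" and "shift \<alpha> (uea_of x) = uea_of x + \<alpha> x *\<^sub>C 1"
  using someI_ex[OF shift_hom_exists[OF abelian assms]] unfolding shift_def by blast+

lemma shift_shift:
  fixes \<alpha> \<beta> :: "'g \<Rightarrow> complex"
  assumes "Vector_Spaces.linear scaleC (*) \<alpha>" "Vector_Spaces.linear scaleC (*) \<beta>"
    "Vector_Spaces.linear scaleC (*) (\<lambda>x. \<alpha> x + \<beta> x)"
  shows "shift \<alpha> (shift \<beta> u) = shift (\<lambda>x. \<alpha> x + \<beta> x) u"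
proof -
  have "shift \<alpha> \<circ> shift \<beta> = shift (\<lambda>x. \<alpha> x + \<beta> x)"
    by (rule uea_hom_eqI)
       (simp_all add: assms shift_hom complex_algebra_hom_comp complex_algebra_homD scaleC_add_left add.assoc)
  thus ?thesis by (metis comp_apply)
qed

lemma shift_zero: "shift (\<lambda>_ :: 'g. 0) u = u"
proof -
  have lin: "Vector_Spaces.linear scaleC (*) (\<lambda>_ :: 'g. 0 :: complex)"
    by unfold_locales (simp_all add: algebra_simps)
  have "shift (\<lambda>_ :: 'g. 0) = id"
    by (rule uea_hom_eqI) (simp_all add: shift_hom[OF lin] complex_algebra_hom_id)
  thus ?thesis by simp
qed

end

section \<open>Weight vectors of a rational torus action\<close>

abbreviation linear_form :: "('b :: complex_vector \<Rightarrow> complex) \<Rightarrow> bool" where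
  "linear_form \<equiv> Vector_Spaces.linear scaleC (*)"

lemma linear_formI:
  "(\<And>x y. \<alpha> (x + y) = \<alpha> x + \<alpha> y) \<Longrightarrow> (\<And>c x. \<alpha> (c *\<^sub>C x) = c * \<alpha> x) \<Longrightarrow> linear_form \<alpha>"
  by unfold_locales (simp_all add: algebra_simps)

lemma linear_formD:
  assumes "linear_form \<alpha>"
  shows "\<alpha> (x + y) = \<alpha> x + \<alpha> y" "\<alpha> (c *\<^sub>C x) = c * \<alpha> x" "\<alpha> 0 = 0" "\<alpha> (x - y) = \<alpha> x - \<alpha> y"
proof -
  interpret \<alpha>: Vector_Spaces.linear scaleC "(*)" \<alpha> by fact
  show "\<alpha> (x + y) = \<alpha> x + \<alpha> y" "\<alpha> (c *\<^sub>C x) = c * \<alpha> x" "\<alpha> 0 = 0" "\<alpha> (x - y) = \<alpha> x - \<alpha> y"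
    by (rule \<alpha>.add \<alpha>.scale \<alpha>.zero \<alpha>.diff)+
qed

lemma linear_form_add: "linear_form \<alpha> \<Longrightarrow> linear_form \<beta> \<Longrightarrow> linear_form (\<lambda>x. \<alpha> x + \<beta> x)"
  by (rule linear_formI) (simp_all add: linear_formD algebra_simps)

text \<open>
  Extending \<open>B\<close> to a basis makes its coordinates linear forms on the whole space, as required for the
  matrix coefficients of a rational action.
\<close>

definition coordinate :: "'b :: complex_vector set \<Rightarrow> 'b \<Rightarrow> 'b \<Rightarrow> complex" where
  "coordinate B b v = complex_vector.representation (complex_vector.extend_basis B) v b"

lemma linear_form_coordinate:
  assumes "complex_vector.independent B"
  shows "linear_form (coordinate B b)"
  using complex_vector.independent_extend_basis[OF assms] complex_vector.span_extend_basis[OF assms]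
  by (intro linear_formI) (simp_all add: coordinate_def complex_vector.representation_add complex_vector.representation_scale)

lemma sum_coordinate:
  assumes "complex_vector.independent B" "finite B" "v \<in> complex_vector.span B"
  shows "(\<Sum>b\<in>B. coordinate B b v *\<^sub>C b) = v"
proof -
  have "complex_vector.representation (complex_vector.extend_basis B) v = complex_vector.representation B v"
    using complex_vector.representation_extend complex_vector.independent_extend_basis
      complex_vector.extend_basis_superset assms by metis
  thus ?thesis
    using complex_vector.sum_representation_eq[OF assms(1,3,2) order_refl] by (simp add: coordinate_def)
qed

lemma linear_forms_separate:
  fixes v w :: "'b :: complex_vector"
  assumes "\<And>\<phi>. linear_form \<phi> \<Longrightarrow> \<phi> v = \<phi> w"
  shows "v = w"
proof (rule ccontr)
  assume "v \<noteq> w"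
  hence indep: "complex_vector.independent {v - w}" by simp
  let ?\<phi> = "coordinate {v - w} (v - w)"
  have lin: "linear_form ?\<phi>" by (rule linear_form_coordinate[OF indep])
  have "?\<phi> (v - w) *\<^sub>C (v - w) = v - w"
    using sum_coordinate[OF indep, of "v - w"] by (simp add: complex_vector.span_base)
  moreover have "?\<phi> (v - w) = 0" using assms[OF lin] linear_formD(4)[OF lin] by simp
  ultimately show False using \<open>v \<noteq> w\<close> by simp
qed

text \<open>
  Dedekind's argument with vector coefficients.  Comparing the relation at \<open>s t\<close> with \<open>\<psi> s\<close> times the
  relation at \<open>t\<close> removes \<open>\<psi>\<close> and multiplies every other coefficient \<open>b \<chi>\<close> by \<open>\<chi> s - \<psi> s\<close>, which
  is nonzero for a suitable \<open>s\<close>.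
\<close>

lemma characters_independent:
  fixes b :: "('t \<Rightarrow> complex) \<Rightarrow> 'b :: complex_vector"
  assumes G: "e \<in> G" "\<And>s t. s \<in> G \<Longrightarrow> t \<in> G \<Longrightarrow> mul s t \<in> G"
    and "finite X"
    and "\<And>\<chi> s t. \<chi> \<in> X \<Longrightarrow> s \<in> G \<Longrightarrow> t \<in> G \<Longrightarrow> \<chi> (mul s t) = \<chi> s * \<chi> t"
    and "\<And>\<chi>. \<chi> \<in> X \<Longrightarrow> \<chi> e = 1"
    and "\<And>\<chi> \<psi>. \<chi> \<in> X \<Longrightarrow> \<psi> \<in> X \<Longrightarrow> \<chi> \<noteq> \<psi> \<Longrightarrow> \<exists>s\<in>G. \<chi> s \<noteq> \<psi> s"
    and "\<And>t. t \<in> G \<Longrightarrow> (\<Sum>\<chi>\<in>X. \<chi> t *\<^sub>C b \<chi>) = 0"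
  shows "\<forall>\<chi>\<in>X. b \<chi> = 0"
  using assms(3-)
proof (induction X arbitrary: b rule: finite_induct)
  case (insert \<psi> X)
  note mul = insert.prems(1) and unit = insert.prems(2) and sep = insert.prems(3) and rel = insert.prems(4)
  have zero: "b \<chi> = 0" if \<chi>: "\<chi> \<in> X" for \<chi>
  proof -
    obtain s where s: "s \<in> G" "\<chi> s \<noteq> \<psi> s" using sep[of \<chi> \<psi>] \<chi> insert.hyps by auto
    have "(\<Sum>\<chi>\<in>X. \<chi> t *\<^sub>C ((\<chi> s - \<psi> s) *\<^sub>C b \<chi>)) = 0" if t: "t \<in> G" for t
    proof -
      have "(\<Sum>\<chi>\<in>insert \<psi> X. \<chi> t *\<^sub>C ((\<chi> s - \<psi> s) *\<^sub>C b \<chi>))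
          = (\<Sum>\<chi>\<in>insert \<psi> X. \<chi> (mul s t) *\<^sub>C b \<chi> - \<psi> s *\<^sub>C (\<chi> t *\<^sub>C b \<chi>))"
        by (rule sum.cong)
           (simp_all add: mul[OF _ s(1) t] scaleC_scaleC algebra_simps flip: complex_vector.scale_left_diff_distrib)
      also have "\<dots> = 0"
        using rel[OF G(2)[OF s(1) t]] rel[OF t]
        by (simp only: sum_subtractf flip: complex_vector.scale_sum_right) simp
      finally show ?thesis using insert.hyps by simp
    qed
    hence "\<forall>\<chi>\<in>X. (\<chi> s - \<psi> s) *\<^sub>C b \<chi> = 0"
      using mul unit sep by (intro insert.IH) auto
    thus ?thesis using \<chi> s(2) by auto
  qed
  hence "b \<psi> = 0" using rel[OF G(1)] unit[of \<psi>] insert.hyps by simp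
  thus ?case using zero by simp
qed simp

text \<open>
  The value \<open>0\<close> off the torus makes characters that agree on the torus equal as functions, whatever their
  exponents at indices \<open>\<ge> n\<close>.
\<close>

definition torus_character :: "nat \<Rightarrow> (nat \<Rightarrow> int) \<Rightarrow> (nat \<Rightarrow> complex) \<Rightarrow> complex" where
  "torus_character n \<mu> t = (if t \<in> torus n then \<Prod>i<n. t i powi \<mu> i else 0)"

lemma torus_one_in: "torus_one \<in> torus n"
  and torus_mult_in: "s \<in> torus n \<Longrightarrow> t \<in> torus n \<Longrightarrow> torus_mult s t \<in> torus n"
  and torus_exp_in: "torus_exp n z \<in> torus n"
  by (simp_all add: torus_def torus_one_def torus_mult_def torus_exp_def)

lemma torus_character_mult:
  "s \<in> torus n \<Longrightarrow> t \<in> torus n \<Longrightarrow>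
    torus_character n \<mu> (torus_mult s t) = torus_character n \<mu> s * torus_character n \<mu> t"
  by (simp add: torus_character_def torus_mult_in)
     (simp add: torus_mult_def power_int_mult_distrib prod.distrib)

lemma torus_character_one: "torus_character n \<mu> torus_one = 1"
  by (simp add: torus_character_def torus_one_in) (simp add: torus_one_def)

lemma torus_character_exp:
  "torus_character n \<mu> (torus_exp n (\<lambda>i. s * x i)) = exp (s * (\<Sum>i<n. of_int (\<mu> i) * x i))"
proof -
  have "torus_character n \<mu> (torus_exp n (\<lambda>i. s * x i)) = (\<Prod>i<n. exp (s * (of_int (\<mu> i) * x i)))"
    by (simp add: torus_character_def torus_exp_in) (simp add: torus_exp_def exp_power_int algebra_simps)
  thus ?thesis by (simp add: exp_sum sum_distrib_left)
qed

text \<open>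
  The coefficients \<open>d\<close> vanish off \<open>X\<close>, so that the expansions of several functions can be written over
  the union of their character sets.
\<close>

lemma torus_regular_characters:
  assumes "torus_regular n f"
  shows "\<exists>X d. finite X \<and> X \<subseteq> range (torus_character n) \<and> (\<forall>\<chi>. \<chi> \<notin> X \<longrightarrow> d \<chi> = 0) \<and>
    (\<forall>t\<in>torus n. f t = (\<Sum>\<chi>\<in>X. d \<chi> * \<chi> t))"
proof -
  obtain S c where S: "finite S" and f: "\<And>t. t \<in> torus n \<Longrightarrow> f t = (\<Sum>\<mu>\<in>S. c \<mu> * (\<Prod>i<n. t i powi \<mu> i))"
    using assms unfolding torus_regular_def by blast
  define d where "d \<chi> = (\<Sum>\<mu> | \<mu> \<in> S \<and> torus_character n \<mu> = \<chi>. c \<mu>)" for \<chi>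
  show ?thesis
  proof (intro exI conjI allI impI ballI)
    show "finite (torus_character n ` S)" using S by simp
    show "d \<chi> = 0" if "\<chi> \<notin> torus_character n ` S" for \<chi>
      unfolding d_def using that by (intro sum.neutral) auto
    show "f t = (\<Sum>\<chi>\<in>torus_character n ` S. d \<chi> * \<chi> t)" if t: "t \<in> torus n" for t
    proof -
      have "f t = (\<Sum>\<mu>\<in>S. c \<mu> * torus_character n \<mu> t)" using f[OF t] t by (simp add: torus_character_def)
      also have "\<dots> = (\<Sum>\<chi>\<in>torus_character n ` S. \<Sum>\<mu> | \<mu> \<in> S \<and> torus_character n \<mu> = \<chi>. c \<mu> * torus_character n \<mu> t)"
        by (rule sum.image_gen[OF S])
      also have "\<dots> = (\<Sum>\<chi>\<in>torus_character n ` S. d \<chi> * \<chi> t)"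
        unfolding d_def sum_distrib_right by (intro sum.cong refl) auto
      finally show ?thesis .
    qed
  qed auto
qed

lemma rational_torus_actionD:
  assumes "rational_torus_action n act"
  shows "t \<in> torus n \<Longrightarrow> Vector_Spaces.linear scaleC scaleC (act t)"
    and "act torus_one v = v"
    and "s \<in> torus n \<Longrightarrow> t \<in> torus n \<Longrightarrow> act (torus_mult s t) v = act s (act t v)"
    and "\<exists>W. finite_dim_subrep n act W \<and> v \<in> W"
    and "finite_dim_subrep n act W \<Longrightarrow> w \<in> W \<Longrightarrow> linear_form \<phi> \<Longrightarrow> torus_regular n (\<lambda>t. \<phi> (act t w))"
  using assms unfolding rational_torus_action_def by simp_all

text \<open>
  Within a finite-dimensional subrepresentation the matrix coefficients of \<open>t\<close> are combinations of
  characters, that is \<open>act t v = (\<Sum>\<chi>\<in>Y. \<chi> t *\<^sub>C w \<chi>)\<close> with fixed vectors \<open>w \<chi>\<close>.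
  Applying \<open>act s\<close> and comparing with the expansion of \<open>act (torus_mult s t) v\<close>, the independence of
  characters shows that each \<open>w \<chi>\<close> is an eigenvector; at \<open>t = 1\<close> they add up to \<open>v\<close>.
\<close>

lemma rational_torus_action_eigenvectors:
  fixes act :: "(nat \<Rightarrow> complex) \<Rightarrow> 'b :: complex_vector \<Rightarrow> 'b"
  assumes act: "rational_torus_action n act"
  shows "v \<in> complex_vector.span {w. \<exists>\<mu>. \<forall>t\<in>torus n. act t w = torus_character n \<mu> t *\<^sub>C w}"
proof -
  note act = rational_torus_actionD[OF act]
  obtain W where W: "finite_dim_subrep n act W" "v \<in> W" using act(4) by blast
  then obtain B0 where B0: "finite B0" "W = complex_vector.span B0" and inv: "\<And>t w. t \<in> torus n \<Longrightarrow> w \<in> W \<Longrightarrow> act t w \<in> W"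
    unfolding finite_dim_subrep_def by blast
  obtain B where B: "B \<subseteq> B0" "complex_vector.independent B" "B0 \<subseteq> complex_vector.span B"
    using complex_vector.maximal_independent_subset[of B0] by blast
  have finB: "finite B" using B(1) B0(1) finite_subset by blast
  have WB: "W \<subseteq> complex_vector.span B"
    unfolding B0(2) using B(3) by (rule complex_vector.span_minimal) (rule complex_vector.subspace_span)
  have regular: "torus_regular n (\<lambda>t. coordinate B b (act t v))" for b
    using act(5)[OF W linear_form_coordinate[OF B(2)]] .
  let ?expansion = "\<lambda>b X d. finite X \<and> X \<subseteq> range (torus_character n) \<and> (\<forall>\<chi>. \<chi> \<notin> X \<longrightarrow> d \<chi> = 0) \<and>
      (\<forall>t\<in>torus n. coordinate B b (act t v) = (\<Sum>\<chi>\<in>X. d \<chi> * \<chi> t))"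
  have "\<forall>b. \<exists>X d. ?expansion b X d"
    using torus_regular_characters[OF regular] by (rule allI)
  from choice[OF this] obtain X where "\<forall>b. \<exists>d. ?expansion b (X b) d" ..
  from choice[OF this] obtain d where "\<forall>b. ?expansion b (X b) (d b)" ..
  hence X: "finite (X b)" "X b \<subseteq> range (torus_character n)"
    and d: "\<chi> \<notin> X b \<Longrightarrow> d b \<chi> = 0"
    and coord: "t \<in> torus n \<Longrightarrow> coordinate B b (act t v) = (\<Sum>\<chi>\<in>X b. d b \<chi> * \<chi> t)" for b \<chi> t
    by simp_all
  define Y where "Y = (\<Union>b\<in>B. X b)"
  have Y: "finite Y" "Y \<subseteq> range (torus_character n)" unfolding Y_def using finB X by auto
  define w where "w \<chi> = (\<Sum>b\<in>B. d b \<chi> *\<^sub>C b)" for \<chi>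
  have expand: "act t v = (\<Sum>\<chi>\<in>Y. \<chi> t *\<^sub>C w \<chi>)" if t: "t \<in> torus n" for t
  proof -
    have "coordinate B b (act t v) = (\<Sum>\<chi>\<in>Y. d b \<chi> * \<chi> t)" if "b \<in> B" for b
      unfolding coord[OF t] using that d Y(1) by (intro sum.mono_neutral_left) (auto simp: Y_def)
    moreover have "act t v = (\<Sum>b\<in>B. coordinate B b (act t v) *\<^sub>C b)"
      using sum_coordinate[OF B(2) finB] inv[OF t W(2)] WB by (metis subsetD)
    ultimately have "act t v = (\<Sum>b\<in>B. \<Sum>\<chi>\<in>Y. \<chi> t *\<^sub>C (d b \<chi> *\<^sub>C b))"
      by (simp add: complex_vector.scale_sum_left scaleC_scaleC mult.commute)
    thus ?thesis
      unfolding w_def complex_vector.scale_sum_right by (subst (asm) sum.swap)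
  qed
  have sep: "\<exists>s\<in>torus n. \<chi> s \<noteq> \<psi> s" if "\<chi> \<in> Y" "\<psi> \<in> Y" "\<chi> \<noteq> \<psi>" for \<chi> \<psi>
  proof -
    obtain s where "\<chi> s \<noteq> \<psi> s" using \<open>\<chi> \<noteq> \<psi>\<close> by blast
    thus ?thesis using that Y(2) by (metis (no_types, lifting) imageE subsetD torus_character_def)
  qed
  have eigen: "act s (w \<chi>) = \<chi> s *\<^sub>C w \<chi>" if "s \<in> torus n" "\<chi> \<in> Y" for s \<chi>
  proof -
    interpret s: Vector_Spaces.linear scaleC scaleC "act s" using act(1)[OF that(1)] .
    have "(\<Sum>\<chi>\<in>Y. \<chi> t *\<^sub>C (act s (w \<chi>) - \<chi> s *\<^sub>C w \<chi>)) = 0" if t: "t \<in> torus n" for t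
    proof -
      have "(\<Sum>\<chi>\<in>Y. \<chi> t *\<^sub>C act s (w \<chi>)) = act s (act t v)"
        by (simp add: expand[OF t] s.sum s.scale)
      also have "\<dots> = act (torus_mult s t) v" using act(3) \<open>s \<in> torus n\<close> t by simp
      also have "\<dots> = (\<Sum>\<chi>\<in>Y. \<chi> (torus_mult s t) *\<^sub>C w \<chi>)"
        using expand torus_mult_in \<open>s \<in> torus n\<close> t by blast
      also have "\<dots> = (\<Sum>\<chi>\<in>Y. \<chi> t *\<^sub>C (\<chi> s *\<^sub>C w \<chi>))"
        using Y(2) torus_character_mult[OF \<open>s \<in> torus n\<close> t]
        by (intro sum.cong refl) (auto simp: scaleC_scaleC mult.commute)
      finally show ?thesis
        by (simp add: complex_vector.scale_right_diff_distrib sum_subtractf)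
    qed
    hence "\<forall>\<chi>\<in>Y. act s (w \<chi>) - \<chi> s *\<^sub>C w \<chi> = 0"
      using Y torus_character_mult torus_character_one sep
      by (intro characters_independent[where G = "torus n" and mul = torus_mult and e = torus_one])
         (auto simp: torus_one_in torus_mult_in)
    thus ?thesis using that(2) by simp
  qed
  have "v = act torus_one v" using act(2) by simp
  also have "\<dots> = (\<Sum>\<chi>\<in>Y. w \<chi>)"
    unfolding expand[OF torus_one_in] using Y(2) torus_character_one
    by (intro sum.cong refl) (auto simp: scaleC_one)
  also have "\<dots> \<in> complex_vector.span {w. \<exists>\<mu>. \<forall>t\<in>torus n. act t w = torus_character n \<mu> t *\<^sub>C w}"
  proof (rule complex_vector.span_sum)
    fix \<chi> assume "\<chi> \<in> Y"
    moreover from this obtain \<mu> where "\<chi> = torus_character n \<mu>" using Y(2) by blast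
    ultimately have "\<forall>t\<in>torus n. act t (w \<chi>) = torus_character n \<mu> t *\<^sub>C w \<chi>" using eigen by blast
    thus "w \<chi> \<in> complex_vector.span {w. \<exists>\<mu>. \<forall>t\<in>torus n. act t w = torus_character n \<mu> t *\<^sub>C w}"
      by (intro complex_vector.span_base) blast
  qed
  finally show ?thesis .
qed

definition weight_vector :: "('g :: complex_lie_algebra uea \<Rightarrow> 'a :: complex_algebra_1) \<Rightarrow> ('g \<Rightarrow> complex) \<Rightarrow> 'a \<Rightarrow> bool" where
  "weight_vector \<iota> \<alpha> a \<longleftrightarrow> linear_form \<alpha> \<and> (\<forall>x. \<iota> (uea_of x) * a - a * \<iota> (uea_of x) = \<alpha> x *\<^sub>C a)"

text \<open>
  For letters this is the definition of a weight vector; it passes to sums and products because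
  \<open>shift \<alpha>\<close> is a homomorphism.
\<close>

lemma weight_vector_commutation:
  fixes \<iota> :: "'g :: complex_lie_algebra uea \<Rightarrow> 'a :: complex_algebra_1"
  assumes abelian: "\<And>x y :: 'g. lie_bracket x y = 0"
    and hom: "complex_algebra_hom \<iota>" and a: "weight_vector \<iota> \<alpha> a"
  shows "\<iota> u * a = a * \<iota> (shift \<alpha> u)"
proof -
  have \<alpha>: "linear_form \<alpha>" and comm: "\<And>x. \<iota> (uea_of x) * a = a * \<iota> (uea_of x) + \<alpha> x *\<^sub>C a"
    using a unfolding weight_vector_def by (auto simp: algebra_simps)
  note sh = shift_hom[OF abelian \<alpha>]
  note simps = complex_algebra_homD[OF hom] complex_algebra_homD[OF sh(1)] sh(2)
  show ?thesis
  proof (induction u rule: uea_induct)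
    case (letter x u)
    have "\<iota> (uea_of x * u) * a = \<iota> (uea_of x) * a * \<iota> (shift \<alpha> u)"
      using letter.IH by (simp add: simps mult.assoc)
    also have "\<dots> = a * \<iota> (shift \<alpha> (uea_of x * u))"
      unfolding comm by (simp add: simps algebra_simps mult_scaleC_left mult_scaleC_right)
    finally show ?case .
  qed (simp_all add: simps distrib_left distrib_right mult_scaleC_left mult_scaleC_right)
qed

context generalized_pair
begin

text \<open>
  Along the one-parameter subgroup of \<open>x\<close> the element is multiplied by \<open>exp (s * \<alpha> x)\<close>, where \<open>\<alpha>\<close>
  is the differential of the character with exponents \<open>\<mu>\<close>; differentiate at \<open>s = 0\<close>.
\<close>

lemma weight_vector_if_eigenvector:
  assumes eigen: "\<forall>t\<in>torus n. act t a = torus_character n \<mu> t *\<^sub>C a"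
  shows "weight_vector \<iota> (\<lambda>x. \<Sum>i<n. of_int (\<mu> i) * coord x i) a"
  unfolding weight_vector_def
proof (intro conjI allI)
  let ?\<alpha> = "\<lambda>x. \<Sum>i<n. of_int (\<mu> i) * coord x i"
  show "linear_form ?\<alpha>"
    using lie_algebra unfolding torus_lie_algebra_def
    by (intro linear_formI) (simp_all add: algebra_simps sum.distrib sum_distrib_left)
  show "\<iota> (uea_of x) * a - a * \<iota> (uea_of x) = ?\<alpha> x *\<^sub>C a" for x
  proof (rule linear_forms_separate)
    fix \<phi> :: "'a \<Rightarrow> complex" assume \<phi>: "linear_form \<phi>"
    have d1: "((\<lambda>s. \<phi> (act (torus_exp n (\<lambda>i. s * coord x i)) a)) has_field_derivative
        \<phi> (\<iota> (uea_of x) * a - a * \<iota> (uea_of x))) (at 0)"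
      using differential[of x a] \<phi> unfolding torus_differential_def by blast
    have curve: "(\<lambda>s. \<phi> (act (torus_exp n (\<lambda>i. s * coord x i)) a)) = (\<lambda>s. exp (s * ?\<alpha> x) * \<phi> a)"
      using eigen torus_exp_in by (simp add: torus_character_exp linear_formD[OF \<phi>])
    have d2: "((\<lambda>s. exp (s * ?\<alpha> x) * \<phi> a) has_field_derivative ?\<alpha> x * \<phi> a) (at 0)"
      by (auto intro!: derivative_eq_intros)
    have "\<phi> (\<iota> (uea_of x) * a - a * \<iota> (uea_of x)) = ?\<alpha> x * \<phi> a"
      by (rule DERIV_unique[OF d1[unfolded curve] d2])
    thus "\<phi> (\<iota> (uea_of x) * a - a * \<iota> (uea_of x)) = \<phi> (?\<alpha> x *\<^sub>C a)"
      by (simp add: linear_formD[OF \<phi>])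
  qed
qed

lemma span_weight_vectors: "complex_vector.span {a. \<exists>\<alpha>. weight_vector \<iota> \<alpha> a} = UNIV"
proof -
  have "{a. \<exists>\<mu>. \<forall>t\<in>torus n. act t a = torus_character n \<mu> t *\<^sub>C a} \<subseteq> {a. \<exists>\<alpha>. weight_vector \<iota> \<alpha> a}"
    using weight_vector_if_eigenvector by blast
  from complex_vector.span_mono[OF this] show ?thesis
    using rational_torus_action_eigenvectors[OF rational] by blast
qed

lemma abelian: "lie_bracket x y = (0 :: 'g)"
  using lie_algebra unfolding torus_lie_algebra_def by blast

lemma noetherian_enveloping_algebra: "noetherian (UNIV :: 'g uea set)"
proof -
  have coord_add: "coord (x + y) i = coord x i + coord y i" and coord_scale: "coord (c *\<^sub>C x) i = c * coord x i"
    and bij: "bij_betw coord UNIV {z. \<forall>i\<ge>n. z i = 0}" for x y c i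
    using lie_algebra unfolding torus_lie_algebra_def by blast+
  define e where "e i = (SOME x. coord x = (\<lambda>j. if j = i then 1 else 0))" for i
  have e: "coord (e i) = (\<lambda>j. if j = i then 1 else 0)" if "i < n" for i
  proof -
    have "(\<lambda>j. if j = i then 1 else 0) \<in> range coord"
      using bij that unfolding bij_betw_def by auto
    hence "\<exists>x. coord x = (\<lambda>j. if j = i then 1 else 0)" by (metis imageE)
    thus ?thesis unfolding e_def by (rule someI_ex)
  qed
  have coord_zero: "coord 0 i = 0" for i using coord_add[of 0 0 i] by simp
  have coord_sum: "coord (\<Sum>i\<in>I. f i) j = (\<Sum>i\<in>I. coord (f i) j)" if "finite I" for I :: "nat set" and f j
    using that by (induction I) (simp_all add: coord_add coord_zero)
  have "x = (\<Sum>i<n. coord x i *\<^sub>C e i)" for x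
  proof -
    have "coord x j = coord (\<Sum>i<n. coord x i *\<^sub>C e i) j" for j
    proof -
      have "coord (\<Sum>i<n. coord x i *\<^sub>C e i) j = (\<Sum>i<n. if j = i then coord x i else 0)"
        unfolding coord_sum[OF finite_lessThan] coord_scale by (intro sum.cong refl) (simp add: e)
      moreover have "j \<ge> n \<Longrightarrow> coord x j = 0" using bij unfolding bij_betw_def by blast
      ultimately show ?thesis by (cases "j < n") simp_all
    qed
    hence "coord x = coord (\<Sum>i<n. coord x i *\<^sub>C e i)" by blast
    thus ?thesis using bij_betw_imp_inj_on[OF bij] by (rule injD[rotated])
  qed
  thus ?thesis by (rule noetherian_uea[OF abelian])
qed

end

section \<open>Associated primes and direct sums\<close>

inductive_set finite_sums :: "'v :: comm_monoid_add set \<Rightarrow> 'v set" for X where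
  zero: "0 \<in> finite_sums X"
| add: "x \<in> X \<Longrightarrow> y \<in> finite_sums X \<Longrightarrow> x + y \<in> finite_sums X"

lemma finite_sums_base: "x \<in> X \<Longrightarrow> x \<in> finite_sums X"
  using finite_sums.add[OF _ finite_sums.zero, of x X] by simp

lemma finite_sums_closed: "x \<in> finite_sums X \<Longrightarrow> y \<in> finite_sums X \<Longrightarrow> x + y \<in> finite_sums X"
  by (induction x rule: finite_sums.induct) (simp_all add: add.assoc finite_sums.add)

lemma finite_sums_subset_insert_zero: "X \<subseteq> insert 0 Y \<Longrightarrow> finite_sums X \<subseteq> finite_sums Y"
proof
  fix x assume X: "X \<subseteq> insert 0 Y" and "x \<in> finite_sums X"
  from this(2) show "x \<in> finite_sums Y"
  proof (induction x rule: finite_sums.induct)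
    case (add x y)
    thus ?case using X finite_sums.add[of x Y y] by auto
  qed (rule finite_sums.zero)
qed

locale commuting_module =
  fixes \<rho> :: "'r :: ring_1 \<Rightarrow> 'v :: ab_group_add \<Rightarrow> 'v"
  assumes module: "left_module \<rho>"
    and commute: "r * s = s * (r :: 'r)"
begin

lemma module_simps:
  "\<rho> r (v + w) = \<rho> r v + \<rho> r w" "\<rho> (r + s) v = \<rho> r v + \<rho> s v" "\<rho> (r * s) v = \<rho> r (\<rho> s v)" "\<rho> 1 v = v"
  using module unfolding left_module_def by blast+

lemma module_zero [simp]: "\<rho> r 0 = 0" "\<rho> 0 v = 0"
  using module_simps(1)[of r 0 0] module_simps(2)[of 0 0 v] by simp_all

lemma module_swap: "\<rho> r (\<rho> s v) = \<rho> s (\<rho> r v)"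
  by (metis module_simps(3) commute)

lemma module_sum: "\<rho> r (sum f F) = (\<Sum>i\<in>F. \<rho> r (f i))"
  by (induction F rule: infinite_finite_induct) (simp_all add: module_simps)

text \<open>
  Subtracting two decompositions of a vector turns uniqueness into the independence of the summands.
\<close>

lemma is_direct_sumI:
  assumes sub: "\<And>i. i \<in> I \<Longrightarrow> is_submodule \<rho> (M i)"
    and total: "finite_sums (\<Union>i\<in>I. M i) = UNIV"
    and independent: "\<And>F h. finite F \<Longrightarrow> F \<subseteq> I \<Longrightarrow> (\<And>i. i \<in> F \<Longrightarrow> h i \<in> M i) \<Longrightarrow> sum h F = 0 \<Longrightarrow>
      \<forall>i\<in>F. h i = 0"
  shows "is_direct_sum \<rho> I (M :: 'i \<Rightarrow> 'v set)"
  unfolding is_direct_sum_def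
proof (intro conjI ballI allI)
  have M0: "0 \<in> M i" if "i \<in> I" for i using sub[OF that] unfolding is_submodule_def by blast
  have M_add: "x + y \<in> M i" if "i \<in> I" "x \<in> M i" "y \<in> M i" for i x y
    using sub[OF that(1)] that unfolding is_submodule_def by blast
  have M_diff: "x - y \<in> M i" if "i \<in> I" "x \<in> M i" "y \<in> M i" for i x y
  proof -
    have "\<rho> (- 1) y \<in> M i" using sub[OF that(1)] that(3) unfolding is_submodule_def by blast
    moreover have "y + \<rho> (- 1) y = 0"
      using module_simps(2)[of 1 "- 1" y] by (simp add: module_simps(4))
    hence "\<rho> (- 1) y = - y" by (simp add: eq_neg_iff_add_eq_0 add.commute)
    ultimately show ?thesis using M_add[OF that(1,2)] by fastforce
  qed
  let ?good = "\<lambda>v f. finite {i. f i \<noteq> 0} \<and> {i. f i \<noteq> 0} \<subseteq> I \<and> (\<forall>i\<in>I. f i \<in> M i) \<and> v = (\<Sum>i | f i \<noteq> 0. f i)"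
  fix v
  have "v \<in> finite_sums (\<Union>i\<in>I. M i)" using total by simp
  hence ex: "\<exists>f. ?good v f"
  proof (induction v rule: finite_sums.induct)
    case zero
    show ?case using M0 by (intro exI[of _ "\<lambda>_. 0"]) simp
  next
    case (add x y)
    then obtain i f where i: "i \<in> I" "x \<in> M i" and f: "?good y f" by blast
    \<comment> \<open>The index \<open>i\<close> is put into the summation set by hand: \<open>f i\<close> or \<open>x + f i\<close> may be \<open>0\<close>.\<close>
    let ?g = "f(i := x + f i)" and ?S = "insert i {j. f j \<noteq> 0}"
    have sub: "{j. ?g j \<noteq> 0} \<subseteq> ?S" by auto
    have S: "finite ?S" "?S \<subseteq> I" using f i by auto
    have "(\<Sum>j | ?g j \<noteq> 0. ?g j) = sum ?g ?S" using S sub by (intro sum.mono_neutral_left) auto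
    also have "\<dots> = x + f i + sum f (?S - {i})"
      using S by (subst sum.remove[of _ i]) (auto intro!: sum.cong)
    also have "\<dots> = x + sum f ?S" using S by (subst (2) sum.remove[of _ i]) (auto simp: add.assoc)
    also have "sum f ?S = y" using f S by (auto intro: sum.mono_neutral_right)
    finally have "x + y = (\<Sum>j | ?g j \<noteq> 0. ?g j)" ..
    moreover have "finite {j. ?g j \<noteq> 0}" "{j. ?g j \<noteq> 0} \<subseteq> I" using S sub finite_subset by blast+
    moreover have "\<forall>j\<in>I. ?g j \<in> M j" using f i M_add by auto
    ultimately show ?case by blast
  qed
  have unique: "f = g" if f: "?good v f" and g: "?good v g" for f g
  proof -
    let ?S = "{i. f i \<noteq> 0} \<union> {i. g i \<noteq> 0}"
    have S: "finite ?S" "?S \<subseteq> I" using f g by auto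
    have "sum f ?S = v"
      using f S(1) by (subst sum.mono_neutral_right[of ?S "{i. f i \<noteq> 0}"]) auto
    moreover have "sum g ?S = v"
      using g S(1) by (subst sum.mono_neutral_right[of ?S "{i. g i \<noteq> 0}"]) auto
    ultimately have "(\<Sum>i\<in>?S. f i - g i) = 0" by (simp only: sum_subtractf) simp
    hence eq: "\<forall>i\<in>?S. f i - g i = 0"
      using S M_diff f g by (intro independent) blast+
    show ?thesis
    proof
      fix i show "f i = g i"
      proof (cases "i \<in> ?S")
        case True
        thus ?thesis using bspec[OF eq True] by simp
      qed simp
    qed
  qed
  show "\<exists>!f. ?good v f" using ex unique by blast
qed (rule sub)

lemma two_sided_ideal_annihilator: "two_sided_ideal (annihilator \<rho> v)"
  by (simp add: two_sided_ideal_def annihilator_def module_simps) (metis commute module_simps(3) module_zero(1))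

lemma submodule_killed_by: "is_submodule \<rho> (killed_by \<rho> P)"
  by (simp add: is_submodule_def killed_by_def module_simps) (metis module_swap module_zero(1))

lemma annihilator_subset: "annihilator \<rho> v \<subseteq> annihilator \<rho> (\<rho> r v)"
proof
  fix s assume "s \<in> annihilator \<rho> v"
  thus "s \<in> annihilator \<rho> (\<rho> r v)" by (simp add: annihilator_def module_swap[of s r v])
qed

text \<open>
  An annihilator that is maximal among those of the nonzero multiples of \<open>v\<close> is prime: if \<open>a b\<close> kills
  \<open>z\<close> and \<open>b z \<noteq> 0\<close>, then the annihilator of \<open>b z\<close> contains that of \<open>z\<close>, so it is equal to it, and it
  contains \<open>a\<close>.
\<close>

lemma associated_prime_above:
  assumes noeth: "noetherian (UNIV :: 'r set)" and v: "v \<noteq> 0"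
  obtains P where "P \<in> associated_primes \<rho>" "annihilator \<rho> v \<subseteq> P"
proof -
  define F where "F = {annihilator \<rho> (\<rho> r v) | r. \<rho> r v \<noteq> 0}"
  have "\<rho> 1 v \<noteq> 0" using v by (simp add: module_simps)
  hence nonempty: "F \<noteq> {}" unfolding F_def by blast
  have ideals: "left_ideal_of UNIV I" if "I \<in> F" for I
    using that two_sided_ideal_annihilator unfolding F_def two_sided_ideal_def left_ideal_of_def by blast
  obtain P where P: "P \<in> F" and max: "\<And>J. J \<in> F \<Longrightarrow> P \<subseteq> J \<Longrightarrow> J = P"
    using noetherian_maximal[OF noeth nonempty ideals] by blast
  obtain r where r: "P = annihilator \<rho> (\<rho> r v)" "\<rho> r v \<noteq> 0" using P unfolding F_def by blast
  have "prime_ideal P"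
    unfolding prime_ideal_def
  proof (intro conjI allI impI)
    show "two_sided_ideal P" unfolding r(1) by (rule two_sided_ideal_annihilator)
    have "1 \<notin> P" using r by (simp add: annihilator_def module_simps)
    thus "P \<noteq> UNIV" by blast
    fix a b assume ab: "a * b \<in> P"
    show "a \<in> P \<or> b \<in> P"
    proof (rule disjCI)
      assume "b \<notin> P"
      hence nz: "\<rho> (b * r) v \<noteq> 0" using r(1) by (simp add: annihilator_def module_simps)
      have "P \<subseteq> annihilator \<rho> (\<rho> (b * r) v)"
        unfolding r(1) module_simps(3) by (rule annihilator_subset)
      moreover have "annihilator \<rho> (\<rho> (b * r) v) \<in> F" using nz unfolding F_def by blast
      ultimately have "annihilator \<rho> (\<rho> (b * r) v) = P" by (rule max[rotated])
      moreover have "a \<in> annihilator \<rho> (\<rho> (b * r) v)"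
        using ab r(1) by (simp add: annihilator_def module_simps)
      ultimately show "a \<in> P" by blast
    qed
  qed
  moreover have "annihilator \<rho> v \<subseteq> P"
    unfolding r(1) by (rule annihilator_subset)
  ultimately show thesis using that[of P] r(1) unfolding associated_primes_def by blast
qed

text \<open>
  If each of the ideals \<open>Q\<close> that kill the summands of \<open>v\<close> had an element outside \<open>P\<close>, then the product
  of these elements would kill \<open>v\<close> without being in the prime \<open>P\<close>.
\<close>

lemma prime_contains_killing_ideal:
  assumes P: "prime_ideal P" and v: "P = annihilator \<rho> v"
    and sum: "v \<in> finite_sums (\<Union>Q\<in>F. killed_by \<rho> Q)"
  shows "\<exists>Q\<in>F. Q \<subseteq> P"
proof (rule ccontr)
  assume none: "\<not> ?thesis"
  have "\<exists>r. r \<notin> P \<and> \<rho> r w = 0" if "w \<in> finite_sums (\<Union>Q\<in>F. killed_by \<rho> Q)" for w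
    using that
  proof (induction w rule: finite_sums.induct)
    case zero
    have "P \<noteq> UNIV" using P unfolding prime_ideal_def by blast
    thus ?case by auto
  next
    case (add x y)
    then obtain Q r where Q: "Q \<in> F" "x \<in> killed_by \<rho> Q" and r: "r \<notin> P" "\<rho> r y = 0" by blast
    obtain q where q: "q \<in> Q" "q \<notin> P" using none Q(1) by blast
    have "\<rho> (q * r) (x + y) = \<rho> r (\<rho> q x) + \<rho> q (\<rho> r y)"
      by (simp add: module_simps module_swap[of q r x])
    also have "\<dots> = 0" using Q(2) q(1) r(2) by (simp add: killed_by_def)
    finally show ?case using P q(2) r(1) unfolding prime_ideal_def by blast
  qed
  from this[OF sum] show False using v by (auto simp: annihilator_def)
qed

text \<open>
  Multiplication by an element of \<open>P0\<close> outside \<open>P\<close> makes the \<open>P0\<close>-component of a relation vanish and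
  is injective on the \<open>P\<close>-component, so it yields a relation with fewer terms.
\<close>

lemma independent_if_torsion_free:
  assumes incomparable: "\<And>P Q. P \<in> F \<Longrightarrow> Q \<in> F \<Longrightarrow> P \<subseteq> Q \<Longrightarrow> P = Q"
    and torsion_free: "\<And>P v. P \<in> F \<Longrightarrow> v \<in> killed_by \<rho> P \<Longrightarrow> v \<noteq> 0 \<Longrightarrow> annihilator \<rho> v = P"
    and "finite F" "\<And>P. P \<in> F \<Longrightarrow> h P \<in> killed_by \<rho> P" "sum h F = 0"
  shows "\<forall>P\<in>F. h P = 0"
  using assms(3,1,2,4,5)
proof (induction F arbitrary: h rule: finite_induct)
  case (insert P0 F)
  have zero: "h P = 0" if P: "P \<in> F" for P
  proof (rule ccontr)
    assume nz: "h P \<noteq> 0"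
    have "\<not> P0 \<subseteq> P" using insert.prems(1)[of P0 P] P insert.hyps(2) by auto
    then obtain r where r: "r \<in> P0" "r \<notin> P" by blast
    have "\<rho> r (h P0) = 0" using insert.prems(3)[of P0] r(1) by (simp add: killed_by_def)
    moreover have "\<rho> r (sum h (insert P0 F)) = 0" using insert.prems(4) by simp
    ultimately have "(\<Sum>P\<in>F. \<rho> r (h P)) = 0"
      using insert.hyps by (simp add: module_simps module_sum)
    moreover have "\<rho> r (h Q) \<in> killed_by \<rho> Q" if "Q \<in> F" for Q
      using submodule_killed_by insert.prems(3)[of Q] that unfolding is_submodule_def by blast
    ultimately have "\<forall>P\<in>F. \<rho> r (h P) = 0"
      using insert.prems(1,2) by (intro insert.IH) auto
    hence "r \<in> annihilator \<rho> (h P)" using P by (simp add: annihilator_def)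
    moreover have "annihilator \<rho> (h P) = P" using insert.prems(2)[of P "h P"] insert.prems(3)[of P] P nz by simp
    ultimately show False using r(2) by blast
  qed
  hence "h P0 = 0" using insert.prems(4) insert.hyps by simp
  thus ?case using zero by blast
qed simp

end

section \<open>Irreducible modules over a generalized pair\<close>

text \<open>
  The zero set of this ideal is that of \<open>P\<close>, translated by \<open>\<alpha>\<close>.
\<close>

definition translate :: "('g :: complex_lie_algebra \<Rightarrow> complex) \<Rightarrow> 'g uea set \<Rightarrow> 'g uea set" where
  "translate \<alpha> P = {u. shift \<alpha> u \<in> P}"

lemma translate_mono: "P \<subseteq> Q \<Longrightarrow> translate \<alpha> P \<subseteq> translate \<alpha> Q"
  unfolding translate_def by blast

context
  assumes abelian: "\<And>x y :: 'g :: complex_lie_algebra. lie_bracket x y = 0"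
begin

lemma translate_translate:
  fixes \<alpha> \<beta> :: "'g \<Rightarrow> complex"
  assumes "linear_form \<alpha>" "linear_form \<beta>"
  shows "translate \<alpha> (translate \<beta> P) = translate (\<lambda>x. \<beta> x + \<alpha> x) P"
  using shift_shift[OF abelian assms(2,1) linear_form_add[OF assms(2,1)]] by (simp add: translate_def)

text \<open>
  Otherwise translating by the negative multiples of \<open>\<alpha>\<close> would produce the strictly increasing chain
  \<open>P \<subset> translate (- \<alpha>) P \<subset> translate (- 2 \<alpha>) P \<subset> \<dots>\<close>.
\<close>

lemma translate_eq_if_subset:
  fixes \<alpha> :: "'g \<Rightarrow> complex"
  assumes noeth: "noetherian (UNIV :: 'g uea set)" and \<alpha>: "linear_form \<alpha>"
    and P: "two_sided_ideal P" and sub: "translate \<alpha> P \<subseteq> P"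
  shows "translate \<alpha> P = P"
proof -
  define \<tau> where "\<tau> c = shift (\<lambda>x. c * \<alpha> x)" for c
  have lin: "linear_form (\<lambda>x. c * \<alpha> x)" for c
    by (rule linear_formI) (simp_all add: linear_formD[OF \<alpha>] algebra_simps)
  have \<tau>: "\<tau> c (\<tau> d u) = \<tau> (c + d) u" for c d u
    using shift_shift[OF abelian lin lin, of c d u] lin[of "c + d"] by (simp add: \<tau>_def distrib_right)
  have \<tau>_one: "\<tau> 1 u = shift \<alpha> u" and \<tau>_zero: "\<tau> 0 u = u" for u
    by (simp_all add: \<tau>_def shift_zero[OF abelian])
  note hom = complex_algebra_homD[OF shift_hom(1)[OF abelian lin], folded \<tau>_def]
  define I where "I k = {u. \<tau> (- of_nat k) u \<in> P}" for k
  have "left_ideal_of UNIV (I k)" for k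
    using P unfolding left_ideal_of_def I_def two_sided_ideal_def by (simp add: hom)
  moreover have "I k \<subseteq> I (Suc k)" for k
  proof
    fix u assume "u \<in> I k"
    hence "\<tau> 1 (\<tau> (- of_nat (Suc k)) u) \<in> P" by (simp add: I_def \<tau>)
    thus "u \<in> I (Suc k)" using sub by (auto simp: \<tau>_one translate_def I_def)
  qed
  ultimately obtain N where N: "\<And>k. k \<ge> N \<Longrightarrow> I k = I N"
    using noetherianD[OF noeth, of I] by blast
  have "P \<subseteq> translate \<alpha> P"
  proof
    fix p assume "p \<in> P"
    hence "\<tau> (of_nat (Suc N)) p \<in> I (Suc N)" by (simp add: I_def \<tau> \<tau>_zero del: of_nat_Suc)
    hence "\<tau> (of_nat (Suc N)) p \<in> I N" using N[of "Suc N"] by simp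
    hence "\<tau> 1 p \<in> P" by (simp add: I_def \<tau>)
    thus "p \<in> translate \<alpha> P" by (simp add: \<tau>_one translate_def)
  qed
  thus ?thesis using sub by blast
qed

end

locale irreducible_module_over_pair = generalized_pair n coord act \<iota>
  for n :: nat and coord :: "'g :: complex_lie_algebra \<Rightarrow> nat \<Rightarrow> complex"
    and act :: "(nat \<Rightarrow> complex) \<Rightarrow> 'a :: complex_algebra_1 \<Rightarrow> 'a" and \<iota> :: "'g uea \<Rightarrow> 'a" +
  fixes m :: "'a \<Rightarrow> 'v :: ab_group_add \<Rightarrow> 'v"
  assumes irreducible: "irreducible_module m"
begin

abbreviation \<rho> :: "'g uea \<Rightarrow> 'v \<Rightarrow> 'v" where "\<rho> \<equiv> \<lambda>u. m (\<iota> u)"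

abbreviation orbit_sum :: "'g uea set \<Rightarrow> 'v set" where
  "orbit_sum P \<equiv> finite_sums (\<Union>Q\<in>{translate \<alpha> P | \<alpha>. linear_form \<alpha>}. killed_by \<rho> Q)"

lemma m_simps:
  "m r (v + w) = m r v + m r w" "m (r + s) v = m r v + m s v" "m (r * s) v = m r (m s v)" "m 1 v = v"
  using irreducible unfolding irreducible_module_def left_module_def by simp_all

lemma submodule_trivial: "is_submodule m W \<Longrightarrow> W = {0} \<or> W = UNIV"
  and nonzero_vector: "\<exists>v :: 'v. v \<noteq> 0"
  using irreducible unfolding irreducible_module_def by auto

lemma m_zero [simp]: "m r 0 = 0" "m 0 v = 0"
  using m_simps(1)[of r 0 0] m_simps(2)[of 0 0 v] by simp_all

sublocale commuting_module \<rho>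
proof
  show "left_module \<rho>"
    unfolding left_module_def by (simp add: m_simps complex_algebra_homD[OF iota_hom])
  show "r * s = s * (r :: 'g uea)" for r s by (rule uea_commute[OF abelian])
qed

lemma weight_vector_killed_by:
  assumes a: "weight_vector \<iota> \<alpha> a" and v: "v \<in> killed_by \<rho> P"
  shows "m a v \<in> killed_by \<rho> (translate \<alpha> P)"
  unfolding killed_by_def
proof (intro CollectI ballI)
  fix u assume u: "u \<in> translate \<alpha> P"
  have "m (\<iota> u) (m a v) = m a (m (\<iota> (shift \<alpha> u)) v)"
    using weight_vector_commutation[OF abelian iota_hom a, of u] by (metis m_simps(3))
  thus "m (\<iota> u) (m a v) = 0" using u v by (simp add: translate_def killed_by_def)
qed

lemma weight_vector_orbit_sum:
  assumes a: "weight_vector \<iota> \<alpha> a" and v: "v \<in> orbit_sum P"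
  shows "m a v \<in> orbit_sum P"
  using v
proof (induction v rule: finite_sums.induct)
  case (add x y)
  then obtain \<beta> where \<beta>: "linear_form \<beta>" "x \<in> killed_by \<rho> (translate \<beta> P)" by blast
  have \<alpha>: "linear_form \<alpha>" using a unfolding weight_vector_def by blast
  have "m a x \<in> killed_by \<rho> (translate (\<lambda>x. \<beta> x + \<alpha> x) P)"
    using weight_vector_killed_by[OF a \<beta>(2)] translate_translate[OF abelian \<alpha> \<beta>(1), of P] by simp
  hence "m a x \<in> (\<Union>Q\<in>{translate \<alpha> P | \<alpha>. linear_form \<alpha>}. killed_by \<rho> Q)"
    using linear_form_add[OF \<beta>(1) \<alpha>] by blast
  from finite_sums.add[OF this add.IH] show ?case by (simp add: m_simps)
qed (simp add: finite_sums.zero)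

text \<open>
  A weight vector maps each \<open>killed_by \<rho> Q\<close> into \<open>killed_by \<rho> (translate \<alpha> Q)\<close>, and the algebra is
  spanned by weight vectors, so the sum over the orbit of \<open>P\<close> is an \<open>\<A>\<close>-submodule.
\<close>

lemma orbit_sum_UNIV:
  assumes v: "v \<in> killed_by \<rho> P" "v \<noteq> 0"
  shows "orbit_sum P = UNIV"
proof -
  have "m a w \<in> orbit_sum P" if w: "w \<in> orbit_sum P" for a w
  proof -
    have "a \<in> complex_vector.span {a. \<exists>\<alpha>. weight_vector \<iota> \<alpha> a}" using span_weight_vectors by simp
    thus ?thesis
    proof (induction a rule: complex_vector.span_induct_alt)
      case base
      show ?case by (simp add: finite_sums.zero)
    next
      case (step c a b)
      then obtain \<alpha> where a: "weight_vector \<iota> \<alpha> a" by blast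
      hence "weight_vector \<iota> \<alpha> (c *\<^sub>C a)"
        unfolding weight_vector_def
        by (simp add: mult_scaleC_left mult_scaleC_right scaleC_scaleC mult.commute
            flip: complex_vector.scale_right_diff_distrib)
      from finite_sums_closed[OF weight_vector_orbit_sum[OF this w] step.IH]
      show ?case by (simp add: m_simps)
    qed
  qed
  hence "is_submodule m (orbit_sum P)"
    unfolding is_submodule_def using finite_sums.zero finite_sums_closed by blast
  moreover have "v \<in> orbit_sum P"
  proof (rule finite_sums_base)
    have "translate (\<lambda>_. 0) P = P" by (simp add: translate_def shift_zero[OF abelian])
    moreover have "linear_form (\<lambda>_ :: 'g. 0)" by (rule linear_formI) simp_all
    ultimately show "v \<in> (\<Union>Q\<in>{translate \<alpha> P | \<alpha>. linear_form \<alpha>}. killed_by \<rho> Q)" using v(1) by blast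
  qed
  ultimately show ?thesis using submodule_trivial v(2) by blast
qed

lemma associated_primeE:
  assumes "P \<in> associated_primes \<rho>"
  obtains v where "prime_ideal P" "two_sided_ideal P" "P = annihilator \<rho> v" "v \<in> killed_by \<rho> P" "v \<noteq> 0"
proof -
  obtain v where v: "prime_ideal P" "P = annihilator \<rho> v"
    using assms unfolding associated_primes_def by blast
  moreover have "v \<in> killed_by \<rho> P" unfolding v(2) killed_by_def annihilator_def by blast
  moreover have "v \<noteq> 0"
    using v unfolding prime_ideal_def by (auto simp: annihilator_def)
  moreover have "two_sided_ideal P" using v(1) unfolding prime_ideal_def by blast
  ultimately show thesis using that by blast
qed

text \<open>
  An element with annihilator \<open>P\<close> lies in the sum over the orbit of \<open>Q\<close>.
\<close>

lemma associated_primes_translates: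
  assumes P: "P \<in> associated_primes \<rho>" and Q: "Q \<in> associated_primes \<rho>"
  obtains \<alpha> where "linear_form \<alpha>" "translate \<alpha> Q \<subseteq> P"
proof -
  obtain v where v: "prime_ideal P" "P = annihilator \<rho> v" using P by (rule associated_primeE)
  obtain w where "w \<in> killed_by \<rho> Q" "w \<noteq> 0" using Q by (rule associated_primeE)
  hence "v \<in> orbit_sum Q" using orbit_sum_UNIV by blast
  from prime_contains_killing_ideal[OF v this] show thesis using that by blast
qed

text \<open>
  An associated prime \<open>R\<close> above the annihilator of \<open>x\<close> has a translate inside \<open>P\<close>, hence one inside
  \<open>translate \<alpha> P\<close>, which is inside \<open>R\<close>.  By the chain condition a translate of \<open>R\<close> inside \<open>R\<close> is
  equal to \<open>R\<close>, so all the ideals in between coincide.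
\<close>

lemma annihilator_eq_translate:
  assumes P: "P \<in> associated_primes \<rho>" and \<alpha>: "linear_form \<alpha>"
    and x: "x \<in> killed_by \<rho> (translate \<alpha> P)" "x \<noteq> 0"
  shows "annihilator \<rho> x = translate \<alpha> P" and "translate \<alpha> P \<in> associated_primes \<rho>"
proof -
  obtain R where R: "R \<in> associated_primes \<rho>" "annihilator \<rho> x \<subseteq> R"
    by (rule associated_prime_above[OF noetherian_enveloping_algebra x(2)])
  have below: "translate \<alpha> P \<subseteq> annihilator \<rho> x" using x(1) by (auto simp: killed_by_def annihilator_def)
  obtain \<beta> where \<beta>: "linear_form \<beta>" "translate \<beta> R \<subseteq> P" by (rule associated_primes_translates[OF P R(1)])
  have "translate (\<lambda>x. \<beta> x + \<alpha> x) R \<subseteq> translate \<alpha> P"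
    using translate_mono[OF \<beta>(2), of \<alpha>] translate_translate[OF abelian \<alpha> \<beta>(1)] by simp
  moreover have "two_sided_ideal R" using R(1) by (rule associated_primeE)
  ultimately have "translate (\<lambda>x. \<beta> x + \<alpha> x) R = R"
    using below R(2) linear_form_add[OF \<beta>(1) \<alpha>]
    by (intro translate_eq_if_subset[OF abelian noetherian_enveloping_algebra]) auto
  hence "R = translate \<alpha> P" "annihilator \<rho> x = translate \<alpha> P"
    using \<open>translate (\<lambda>x. \<beta> x + \<alpha> x) R \<subseteq> translate \<alpha> P\<close> below R(2) by auto
  thus "annihilator \<rho> x = translate \<alpha> P" "translate \<alpha> P \<in> associated_primes \<rho>" using R(1) by auto
qed

lemma annihilator_eq_associated_prime:
  assumes "P \<in> associated_primes \<rho>" "x \<in> killed_by \<rho> P" "x \<noteq> 0"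
  shows "annihilator \<rho> x = P"
proof -
  have "translate (\<lambda>_. 0) P = P" by (simp add: translate_def shift_zero[OF abelian])
  moreover have "linear_form (\<lambda>_ :: 'g. 0)" by (rule linear_formI) simp_all
  ultimately show ?thesis using annihilator_eq_translate(1)[OF assms(1), of "\<lambda>_. 0" x] assms by simp
qed

lemma associated_primes_incomparable:
  assumes P: "P \<in> associated_primes \<rho>" and Q: "Q \<in> associated_primes \<rho>" and "P \<subseteq> Q"
  shows "P = Q"
proof -
  obtain v where v: "Q = annihilator \<rho> v" "v \<in> killed_by \<rho> Q" "v \<noteq> 0" using Q by (rule associated_primeE)
  have "v \<in> killed_by \<rho> P" using v(2) \<open>P \<subseteq> Q\<close> unfolding killed_by_def by blast
  from annihilator_eq_associated_prime[OF P this v(3)] show ?thesis using v(1) by simp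
qed

theorem direct_sum_associated_primes:
  "is_direct_sum \<rho> (associated_primes \<rho>) (killed_by \<rho>)"
proof (rule is_direct_sumI)
  show "is_submodule \<rho> (killed_by \<rho> P)" for P by (rule submodule_killed_by)
  show "finite_sums (\<Union>P\<in>associated_primes \<rho>. killed_by \<rho> P) = UNIV"
  proof -
    obtain v :: 'v where "v \<noteq> 0" using nonzero_vector by blast
    then obtain P where P: "P \<in> associated_primes \<rho>"
      by (rule associated_prime_above[OF noetherian_enveloping_algebra])
    obtain w where "w \<in> killed_by \<rho> P" "w \<noteq> 0" using P by (rule associated_primeE)
    hence total: "orbit_sum P = UNIV" by (rule orbit_sum_UNIV)
    have "(\<Union>Q\<in>{translate \<alpha> P | \<alpha>. linear_form \<alpha>}. killed_by \<rho> Q)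
        \<subseteq> insert 0 (\<Union>P\<in>associated_primes \<rho>. killed_by \<rho> P)"
      using annihilator_eq_translate(2)[OF P] by blast
    from finite_sums_subset_insert_zero[OF this] show ?thesis unfolding total by (rule top_le)
  qed
  show "\<forall>P\<in>F. h P = 0"
    if F: "finite F" "F \<subseteq> associated_primes \<rho>" "\<And>P. P \<in> F \<Longrightarrow> h P \<in> killed_by \<rho> P" "sum h F = 0" for F h
  proof (rule independent_if_torsion_free[OF _ _ F(1,3,4)])
    show "P = Q" if "P \<in> F" "Q \<in> F" "P \<subseteq> Q" for P Q
      using associated_primes_incomparable[of P Q] F(2) that by blast
    show "annihilator \<rho> v = P" if "P \<in> F" "v \<in> killed_by \<rho> P" "v \<noteq> 0" for P v
      using annihilator_eq_associated_prime[of P v] F(2) that by blast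
  qed
qed

end

theorem theorem3p33:
  fixes n :: nat
    and coord :: "'g :: complex_lie_algebra \<Rightarrow> nat \<Rightarrow> complex"
    and act :: "(nat \<Rightarrow> complex) \<Rightarrow> 'a :: complex_algebra_1 \<Rightarrow> 'a"
    and \<iota> :: "'g uea \<Rightarrow> 'a"
    and m :: "'a \<Rightarrow> 'v :: ab_group_add \<Rightarrow> 'v"
  assumes "generalized_pair n coord act \<iota>"
    and "countable_dimension TYPE('a)"
    and "irreducible_module m"
  shows "is_direct_sum (\<lambda>u. m (\<iota> u)) (associated_primes (\<lambda>u. m (\<iota> u)))
    (killed_by (\<lambda>u. m (\<iota> u)))"
proof -
  interpret irreducible_module_over_pair n coord act \<iota> m
    using assms by (intro irreducible_module_over_pair.intro irreducible_module_over_pair_axioms.intro)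
  show ?thesis by (rule direct_sum_associated_primes)
qed

end
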